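(* Let $a>0$, and let $g$ be a compactly supported function on $\mathbb R$ such that its left/right limits $g^{\pm}(t)=\lim_{s\to t^{\pm}}g(s)$ are well defined (at every $t\in\mathbb R$). Then $\mathcal{G}(g;a)=\{e^{-2\pi i m x}g(x-na):m,n\in\mathbb Z\}$ is not a frame for $L^2(\mathbb R)$ if and only if there exist $t_0\in\mathbb R$ and a nonzero bounded sequence $\{q_j\}_{j\in\mathbb Z}\in\ell^\infty$ such that $$\sum_{j\in\mathbb Z}q_j\,h(t_0+j-na)=0\quad\text{for all } n\in\mathbb Z,$$ for either $h=g^+$ or $h=g^-$.
   Context: A countable system $\{g_k\}$ is a frame for $L^2(\mathbb R)$ if there are constants $A,B>0$ with $A\|f\|_2^2\le\sum_k|\langle f,g_k\rangle|^2\le B\|f\|_2^2$ for all $f\in L^2(\mathbb R)$. *)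

theory Defs
  imports "HOL-Analysis.Analysis"
begin

(* Every Lebesgue measurable function agrees almost everywhere with a Borel measurable one, so Borel
   functions represent all elements of L^2(R).  Functions that agree almost everywhere are not
   identified; the norm and the inner product do not distinguish them. *)
definition L2R :: "(real \<Rightarrow> complex) set" where
  "L2R = {f \<in> borel_measurable lborel. integrable lborel (\<lambda>x. (norm (f x))\<^sup>2)}"

definition L2_norm :: "(real \<Rightarrow> complex) \<Rightarrow> real" where
  "L2_norm f = sqrt (\<integral>x. (norm (f x))\<^sup>2 \<partial>lborel)"

definition L2_inner :: "(real \<Rightarrow> complex) \<Rightarrow> (real \<Rightarrow> complex) \<Rightarrow> complex" where
  "L2_inner f g = (\<integral>x. f x * cnj (g x) \<partial>lborel)"

(* infsum is 0 for a series that does not converge, so summability is required separately. *)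
definition L2_frame :: "('k :: countable \<Rightarrow> real \<Rightarrow> complex) \<Rightarrow> bool" where
  "L2_frame G \<longleftrightarrow>
     (\<forall>k. G k \<in> L2R) \<and>
     (\<exists>A>0. \<exists>B>0. \<forall>f\<in>L2R.
        (\<lambda>k. (norm (L2_inner f (G k)))\<^sup>2) summable_on UNIV \<and>
        A * (L2_norm f)\<^sup>2 \<le> (\<Sum>\<^sub>\<infinity>k. (norm (L2_inner f (G k)))\<^sup>2) \<and>
        (\<Sum>\<^sub>\<infinity>k. (norm (L2_inner f (G k)))\<^sup>2) \<le> B * (L2_norm f)\<^sup>2)"

definition gabor_system :: "(real \<Rightarrow> complex) \<Rightarrow> real \<Rightarrow> int \<times> int \<Rightarrow> real \<Rightarrow> complex" where
  "gabor_system g a = (\<lambda>(m, n) x.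
     exp (- 2 * complex_of_real pi * \<i> * of_int m * complex_of_real x) * g (x - of_int n * a))"

definition has_one_sided_limits :: "(real \<Rightarrow> complex) \<Rightarrow> bool" where
  "has_one_sided_limits g \<longleftrightarrow>
     (\<forall>t. (\<exists>l. (g \<longlongrightarrow> l) (at_right t)) \<and> (\<exists>l. (g \<longlongrightarrow> l) (at_left t)))"

definition right_lim :: "(real \<Rightarrow> complex) \<Rightarrow> real \<Rightarrow> complex" where
  "right_lim g t = Lim (at_right t) g"

definition left_lim :: "(real \<Rightarrow> complex) \<Rightarrow> real \<Rightarrow> complex" where
  "left_lim g t = Lim (at_left t) g"

end

theory Submission
  imports Defs
begin

text \<open>
  Fix \<open>t\<close> and consider the banded matrix with entries \<open>g (t + j - n a)\<close>.  By Parseval's identity on the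
  unit interval, \<open>\<Sum>\<^sub>m\<^sub>,\<^sub>n \<bar>\<langle>f, g\<^sub>m\<^sub>,\<^sub>n\<rangle>\<bar>\<^sup>2\<close> is the integral over \<open>t \<in> [0,1)\<close> of the squared norm of this
  matrix applied to the fibre \<open>(f (t + j))\<^sub>j\<close>, up to conjugation.  So the frame property says that these matrices are bounded
  and bounded below on square-summable sequences, uniformly in almost every \<open>t\<close>; the upper bound is
  Schur's test.  Since \<open>g\<close> has only countably many discontinuities, it may be replaced by \<open>g\<^sup>+\<close>.

  If the lower bound fails, there are almost-kernel vectors of arbitrarily small relative defect.
  A maximal-function argument with weights \<open>exp (- \<delta> \<bar>j - i\<bar>)\<close> recentres such a vector at an index where
  it nearly dominates, so that after normalisation it grows at most like \<open>exp (\<delta> \<bar>j\<bar>)\<close>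
  and has small defect locally.  Letting \<open>\<delta> \<rightarrow> 0\<close>, compactness gives a bounded nonzero kernel vector at a limit
  point \<open>t\<^sub>0\<close>, for \<open>g\<^sup>+\<close> or \<open>g\<^sup>-\<close> according to the side from which \<open>t\<^sub>0\<close> is approached.
  Conversely, a bounded kernel vector multiplied by a wide triangular cut-off is an almost-kernel vector
  of finite support, and one-sided continuity makes it one for all \<open>t\<close> in an interval ending at \<open>t\<^sub>0\<close>; the
  function with these fibres violates the lower frame bound.
\<close>

subsection \<open>Fourier series on the unit interval\<close>

text \<open>The half-open interval is a fundamental domain: each real is uniquely
  \<open>x + of_int j\<close> with \<open>x\<close> in it. This makes periodization exact.\<close>

definition circle_measure :: "real measure" where
  "circle_measure = restrict_space lborel {0..<1}"

definition fourier_char :: "int \<Rightarrow> real \<Rightarrow> complex" where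
  "fourier_char m x = cis (2 * pi * of_int m * x)"

text \<open>The coefficient of \<open>fourier_char (- m)\<close>: the sign of the exponent is that of \<open>L2_inner f (gabor_system g a (m, n))\<close>.\<close>

definition fourier_coeff :: "(real \<Rightarrow> complex) \<Rightarrow> int \<Rightarrow> complex" where
  "fourier_coeff F m = (\<integral>x. F x * fourier_char m x \<partial>circle_measure)"

text \<open>Stated for an arbitrary measure so that one set of closure rules serves both
  \<open>circle_measure\<close> and \<open>lborel\<close>; over \<open>lborel\<close> it is
  membership in \<open>L2R\<close>.\<close>

definition sqint :: "'a measure \<Rightarrow> ('a \<Rightarrow> complex) \<Rightarrow> bool" where
  "sqint M F \<longleftrightarrow> F \<in> borel_measurable M \<and> integrable M (\<lambda>x. (norm (F x))\<^sup>2)"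

lemma space_circle [simp]: "space circle_measure = {0..<1}"
  by (simp add: circle_measure_def space_restrict_space)

lemma sets_circle [measurable_cong]: "sets circle_measure = sets (restrict_space borel {0..<1})"
  unfolding circle_measure_def by (rule sets_restrict_space_cong) simp

lemma emeasure_circle: "emeasure circle_measure {0..<1} = 1"
  unfolding circle_measure_def by (subst emeasure_restrict_space) auto

interpretation circle_measure: finite_measure circle_measure
  by standard (simp add: emeasure_circle)

lemma measure_circle [simp]: "measure circle_measure {0..<1} = 1"
  by (simp add: measure_def emeasure_circle)

lemma borel_measurable_circle:
  "F \<in> borel_measurable borel \<Longrightarrow> F \<in> borel_measurable circle_measure"
  unfolding circle_measure_def by (simp add: measurable_restrict_space1)

lemma fourier_char_measurable [measurable]: "fourier_char m \<in> borel_measurable borel"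
  unfolding fourier_char_def cis_conv_exp by measurable

lemma fourier_char_circle [measurable]: "fourier_char m \<in> borel_measurable circle_measure"
  by (intro borel_measurable_circle) simp

lemma norm_fourier_char [simp]: "norm (fourier_char m x) = 1"
  by (simp add: fourier_char_def)

lemma fourier_char_add: "fourier_char (m + n) x = fourier_char m x * fourier_char n x"
  by (simp add: fourier_char_def cis_mult algebra_simps)

lemma fourier_char_0 [simp]: "fourier_char 0 x = 1"
  by (simp add: fourier_char_def)

lemma cnj_fourier_char: "cnj (fourier_char m x) = fourier_char (- m) x"
  by (simp add: fourier_char_def cis_cnj)

lemma fourier_char_int_shift: "fourier_char m (x + of_int j) = fourier_char m x"
proof -
  have "fourier_char m (x + of_int j) = cis (2 * pi * of_int m * x) * cis (2 * pi * of_int (m * j))"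
    by (simp add: fourier_char_def cis_mult algebra_simps)
  also have "cis (2 * pi * of_int (m * j)) = 1"
    by (rule cis_multiple_2pi) simp
  finally show ?thesis by (simp add: fourier_char_def)
qed

text \<open>For \<open>m \<noteq> 0\<close> the primitive \<open>exp (c * of_real x) / c\<close> is
  1-periodic, so its values at 0 and 1 cancel.\<close>

lemma integral_fourier_char: "(\<integral>x. fourier_char m x \<partial>circle_measure) = (if m = 0 then 1 else 0)"
proof (cases "m = 0")
  case True
  then show ?thesis by simp
next
  case False
  define c :: complex where "c = 2 * pi * \<i> * of_int m"
  have c: "c \<noteq> 0" using False by (simp add: c_def)
  have fourier_char: "fourier_char m x = exp (c * of_real x)" for x
    by (simp add: fourier_char_def cis_conv_exp c_def mult_ac)
  have der: "((\<lambda>x. exp (c * of_real x) / c) has_vector_derivative fourier_char m x) (at x within {0..1})" for x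
  proof -
    have "((\<lambda>z. exp (c * z) / c) has_field_derivative fourier_char m x) (at (of_real x))"
      unfolding fourier_char by (rule derivative_eq_intros | use c in simp)+
    then show ?thesis by (rule has_vector_derivative_real_field)
  qed
  have "(\<integral>x. fourier_char m x \<partial>circle_measure) = (\<integral>x. indicator {0..<1} x *\<^sub>R fourier_char m x \<partial>lborel)"
    unfolding circle_measure_def by (rule integral_restrict_space) simp
  \<comment> \<open>The fundamental theorem of calculus wants the closed interval; the added
    endpoint is a null set.\<close>
  also have "\<dots> = (\<integral>x. indicator {0..1} x *\<^sub>R fourier_char m x \<partial>lborel)"
    by (rule integral_cong_AE)
       (use AE_lborel_singleton[of "1::real"] in \<open>auto elim!: eventually_mono simp: indicator_def\<close>)
  also have "\<dots> = exp (c * of_real 1) / c - exp (c * of_real 0) / c"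
    by (rule integral_FTC_Icc) (use der in \<open>auto simp: fourier_char intro!: continuous_intros\<close>)
  also have "exp (c * of_real 1) = fourier_char m (0 + of_int 1)" by (simp add: fourier_char)
  also have "\<dots> = 1" by (subst fourier_char_int_shift) (simp add: fourier_char_def)
  finally show ?thesis using False by simp
qed

section \<open>Closure properties of square-integrable functions\<close>

lemma norm_add_sq_le: "(norm (x + y :: complex))\<^sup>2 \<le> 2 * ((norm x)\<^sup>2 + (norm y)\<^sup>2)"
proof -
  have "(norm (x + y))\<^sup>2 \<le> (norm x + norm y)\<^sup>2"
    by (intro power_mono norm_triangle_ineq) simp
  also have "\<dots> \<le> 2 * ((norm x)\<^sup>2 + (norm y)\<^sup>2)"
    using sum_squares_bound[of "norm x" "norm y"] by (simp add: power2_sum)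
  finally show ?thesis .
qed

lemma sqint_bound:
  assumes "G \<in> borel_measurable M" "sqint M F" "\<And>x. norm (G x) \<le> C * norm (F x)"
  shows "sqint M G"
  unfolding sqint_def
proof (intro conjI)
  show "integrable M (\<lambda>x. (norm (G x))\<^sup>2)"
  proof (rule Bochner_Integration.integrable_bound)
    show "integrable M (\<lambda>x. C\<^sup>2 * (norm (F x))\<^sup>2)" using assms(2) by (simp add: sqint_def)
    have "(norm (G x))\<^sup>2 \<le> C\<^sup>2 * (norm (F x))\<^sup>2" for x
      using power_mono[OF assms(3)[of x] norm_ge_zero, of 2] by (simp add: power_mult_distrib)
    then show "AE x in M. norm ((norm (G x))\<^sup>2) \<le> norm (C\<^sup>2 * (norm (F x))\<^sup>2)"
      by (simp add: abs_mult)
    show "(\<lambda>x. (norm (G x))\<^sup>2) \<in> borel_measurable M" using assms(1) by measurable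
  qed
qed fact

lemma sqint_add:
  assumes "sqint M F" "sqint M G" shows "sqint M (\<lambda>x. F x + G x)"
  unfolding sqint_def
proof (intro conjI)
  have [measurable]: "F \<in> borel_measurable M" "G \<in> borel_measurable M"
    using assms by (auto simp: sqint_def)
  show "(\<lambda>x. F x + G x) \<in> borel_measurable M" by measurable
  show "integrable M (\<lambda>x. (norm (F x + G x))\<^sup>2)"
  proof (rule Bochner_Integration.integrable_bound)
    show "integrable M (\<lambda>x. 2 * ((norm (F x))\<^sup>2 + (norm (G x))\<^sup>2))"
      using assms by (simp add: sqint_def)
  qed (use norm_add_sq_le in auto)
qed

lemma sqint_minus: "sqint M F \<Longrightarrow> sqint M (\<lambda>x. - F x)"
  by (simp add: sqint_def)

lemma sqint_diff: "sqint M F \<Longrightarrow> sqint M G \<Longrightarrow> sqint M (\<lambda>x. F x - G x)"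
  using sqint_add[of M F "\<lambda>x. - G x"] by (simp add: sqint_minus)

lemma sqint_sum: "(\<And>i. i \<in> I \<Longrightarrow> sqint M (F i)) \<Longrightarrow> sqint M (\<lambda>x. \<Sum>i\<in>I. F i x)"
proof (induction I rule: infinite_finite_induct)
  case (insert i I)
  then show ?case by (simp add: sqint_add)
qed (simp_all add: sqint_def)

lemma sqint_cmult: "sqint M F \<Longrightarrow> sqint M (\<lambda>x. c * F x)"
  by (auto simp: sqint_def norm_mult power_mult_distrib)

lemma integrable_mult_sqint:
  assumes "sqint M F" "sqint M G"
  shows "integrable M (\<lambda>x. F x * G x)"
proof (rule Bochner_Integration.integrable_bound)
  have [measurable]: "F \<in> borel_measurable M" "G \<in> borel_measurable M"
    using assms by (auto simp: sqint_def)
  show "integrable M (\<lambda>x. (norm (F x))\<^sup>2 + (norm (G x))\<^sup>2)" using assms by (simp add: sqint_def)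
  show "(\<lambda>x. F x * G x) \<in> borel_measurable M" by measurable
  have "norm (F x * G x) \<le> (norm (F x))\<^sup>2 + (norm (G x))\<^sup>2" for x
    using sum_squares_bound[of "norm (F x)" "norm (G x)"] zero_le_power2[of "norm (F x)"]
      zero_le_power2[of "norm (G x)"] unfolding norm_mult by linarith
  then show "AE x in M. norm (F x * G x) \<le> norm ((norm (F x))\<^sup>2 + (norm (G x))\<^sup>2)"
    by simp
qed

section \<open>Orthogonality of characters and mean-square errors\<close>

lemma sqint_fourier_char: "sqint circle_measure (fourier_char m)"
  by (simp add: sqint_def)

lemma fourier_coeff_diff:
  assumes "sqint circle_measure F" "sqint circle_measure G"
  shows "fourier_coeff (\<lambda>x. F x - G x) m = fourier_coeff F m - fourier_coeff G m"
  unfolding fourier_coeff_def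
  using integrable_mult_sqint[OF assms(1) sqint_fourier_char] integrable_mult_sqint[OF assms(2) sqint_fourier_char]
  by (simp add: left_diff_distrib)

lemma fourier_coeff_cmult_fourier_char: "fourier_coeff (\<lambda>x. c * fourier_char (- n) x) m = (if m = n then c else 0)"
proof -
  have "fourier_coeff (\<lambda>x. c * fourier_char (- n) x) m = (\<integral>x. c * fourier_char (m - n) x \<partial>circle_measure)"
    unfolding fourier_coeff_def by (rule Bochner_Integration.integral_cong) (simp_all add: fourier_char_add[of m "-n", simplified])
  also have "\<dots> = (if m = n then c else 0)"
    using integral_fourier_char[of "m - n"] by auto
  finally show ?thesis .
qed

text \<open>Expanding the square leaves
  \<open>(norm c)\<^sup>2 - 2 * Re (cnj c * fourier_coeff F m)\<close> beyond the norm of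
  \<open>F\<close>; completing the square in \<open>c\<close> isolates the excess error of a
  non-optimal coefficient.\<close>

lemma integral_norm_diff_fourier_char:
  assumes F: "sqint circle_measure F"
  shows "(\<integral>x. (norm (F x - c * fourier_char (- m) x))\<^sup>2 \<partial>circle_measure)
     = (\<integral>x. (norm (F x))\<^sup>2 \<partial>circle_measure) - (norm (fourier_coeff F m))\<^sup>2 + (norm (fourier_coeff F m - c))\<^sup>2"
proof -
  have i1: "integrable circle_measure (\<lambda>x. (norm (F x))\<^sup>2)" using F by (simp add: sqint_def)
  have i2: "integrable circle_measure (\<lambda>x. cnj c * (F x * fourier_char m x))"
    using integrable_mult_sqint[OF F sqint_fourier_char] by simp
  have "(norm (F x - c * fourier_char (- m) x))\<^sup>2 = (norm (F x))\<^sup>2 - 2 * Re (cnj c * (F x * fourier_char m x)) + (norm c)\<^sup>2" for x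
  proof -
    have "complex_of_real ((norm (F x - c * fourier_char (- m) x))\<^sup>2) =
        (F x - c * fourier_char (- m) x) * cnj (F x - c * fourier_char (- m) x)"
      by (rule complex_norm_square)
    also have "\<dots> = F x * cnj (F x) - (cnj c * (F x * fourier_char m x) + cnj (cnj c * (F x * fourier_char m x)))
        + (c * cnj c) * (fourier_char (- m) x * fourier_char m x)"
      by (simp add: cnj_fourier_char algebra_simps)
    also have "fourier_char (- m) x * fourier_char m x = 1"
      using fourier_char_add[of "- m" m x] by simp
    also have "cnj c * (F x * fourier_char m x) + cnj (cnj c * (F x * fourier_char m x)) = of_real (2 * Re (cnj c * (F x * fourier_char m x)))"
      by (rule complex_add_cnj)
    also have "F x * cnj (F x) = of_real ((norm (F x))\<^sup>2)" by (rule complex_norm_square[symmetric])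
    also have "c * cnj c = of_real ((norm c)\<^sup>2)" by (rule complex_norm_square[symmetric])
    finally have "complex_of_real ((norm (F x - c * fourier_char (- m) x))\<^sup>2) =
      of_real ((norm (F x))\<^sup>2 - 2 * Re (cnj c * (F x * fourier_char m x)) + (norm c)\<^sup>2)" by simp
    then show ?thesis by (simp only: of_real_eq_iff)
  qed
  \<comment> \<open>The cross term is hidden behind the name \<open>R\<close>, so that linearity of
    the integral treats it as one unit.\<close>
  then obtain R where R: "R = (\<lambda>x. Re (cnj c * (F x * fourier_char m x)))"
    and nR: "\<And>x. (norm (F x - c * fourier_char (- m) x))\<^sup>2 = (norm (F x))\<^sup>2 - 2 * R x + (norm c)\<^sup>2"
    by blast
  have "integrable circle_measure R" unfolding R by (rule integrable_Re[OF i2])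
  then have "(\<integral>x. (norm (F x - c * fourier_char (- m) x))\<^sup>2 \<partial>circle_measure)
     = (\<integral>x. (norm (F x))\<^sup>2 \<partial>circle_measure) - 2 * (\<integral>x. R x \<partial>circle_measure) + (norm c)\<^sup>2"
    unfolding nR using i1 by simp
  also have "(\<integral>x. R x \<partial>circle_measure) = Re (cnj c * fourier_coeff F m)"
    using integral_Re[OF i2] by (simp add: fourier_coeff_def R)
  finally have 1: "(\<integral>x. (norm (F x - c * fourier_char (- m) x))\<^sup>2 \<partial>circle_measure)
     = (\<integral>x. (norm (F x))\<^sup>2 \<partial>circle_measure) - 2 * Re (cnj c * fourier_coeff F m) + (norm c)\<^sup>2" .
  have 2: "(norm c)\<^sup>2 - 2 * Re (cnj c * fourier_coeff F m) = - (norm (fourier_coeff F m))\<^sup>2 + (norm (fourier_coeff F m - c))\<^sup>2"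
    unfolding cmod_power2 by (simp add: power2_eq_square algebra_simps)
  show ?thesis using 1 2 by linarith
qed

text \<open>Induction on the frequencies: by orthogonality, subtracting the terms already in
  \<open>K\<close> leaves the coefficient at a new \<open>m\<close> unchanged, so the one-frequency
  identity applies again. The choice \<open>c = fourier_coeff F\<close> gives Bessel; an arbitrary
  \<open>c\<close> bounds the error from below in Parseval.\<close>

lemma integral_norm_diff_trig:
  assumes F: "sqint circle_measure F" and "finite K"
  shows "(\<integral>x. (norm (F x - (\<Sum>m\<in>K. c m * fourier_char (- m) x)))\<^sup>2 \<partial>circle_measure)
     = (\<integral>x. (norm (F x))\<^sup>2 \<partial>circle_measure) - (\<Sum>m\<in>K. (norm (fourier_coeff F m))\<^sup>2) + (\<Sum>m\<in>K. (norm (fourier_coeff F m - c m))\<^sup>2)"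
  using \<open>finite K\<close>
proof (induction K)
  case (insert m K)
  let ?T = "\<lambda>K x. \<Sum>m\<in>K. c m * fourier_char (- m) x"
  have T: "sqint circle_measure (?T K)" by (intro sqint_sum sqint_cmult sqint_fourier_char)
  have "fourier_coeff (?T K) m = (\<Sum>n\<in>K. fourier_coeff (\<lambda>x. c n * fourier_char (- n) x) m)"
    unfolding fourier_coeff_def sum_distrib_right
    by (rule Bochner_Integration.integral_sum) (intro integrable_mult_sqint sqint_cmult sqint_fourier_char)
  also have "\<dots> = 0" using insert.hyps by (intro sum.neutral) (auto simp: fourier_coeff_cmult_fourier_char)
  finally have fc: "fourier_coeff (\<lambda>x. F x - ?T K x) m = fourier_coeff F m"
    by (simp add: fourier_coeff_diff[OF F T])
  have "(\<integral>x. (norm (F x - ?T (insert m K) x))\<^sup>2 \<partial>circle_measure) = (\<integral>x. (norm ((F x - ?T K x) - c m * fourier_char (- m) x))\<^sup>2 \<partial>circle_measure)"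
    using insert.hyps by (simp add: algebra_simps)
  also have "\<dots> = (\<integral>x. (norm (F x - ?T K x))\<^sup>2 \<partial>circle_measure) - (norm (fourier_coeff F m))\<^sup>2 + (norm (fourier_coeff F m - c m))\<^sup>2"
    using integral_norm_diff_fourier_char[OF sqint_diff[OF F T], of "c m" m] unfolding fc by simp
  finally show ?case using insert by simp
qed simp

section \<open>Trigonometric polynomials and their mean-square density\<close>

inductive trigpoly :: "(real \<Rightarrow> complex) \<Rightarrow> bool" where
  mono: "trigpoly (\<lambda>x. c * fourier_char m x)"
| add: "trigpoly p \<Longrightarrow> trigpoly q \<Longrightarrow> trigpoly (\<lambda>x. p x + q x)"

lemma trigpoly_mult: "trigpoly p \<Longrightarrow> trigpoly r \<Longrightarrow> trigpoly (\<lambda>x. p x * r x)"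
proof (induction p rule: trigpoly.induct)
  case (mono c m)
  then show ?case
  proof (induction r rule: trigpoly.induct)
    case (mono d n)
    then show ?case
      using trigpoly.mono[of "c * d" "m + n"] by (simp add: fourier_char_add mult_ac)
  next
    case (add p q)
    then show ?case using trigpoly.add[of "\<lambda>x. c * fourier_char m x * p x" "\<lambda>x. c * fourier_char m x * q x"]
      by (simp add: distrib_left)
  qed
next
  case (add p q)
  then show ?case using trigpoly.add[of "\<lambda>x. p x * r x" "\<lambda>x. q x * r x"]
    by (simp add: distrib_right)
qed

lemma trigpoly_sum:
  assumes "trigpoly p"
  shows "\<exists>K c. finite K \<and> p = (\<lambda>x. \<Sum>m\<in>K. c m * fourier_char (- m) x)"
  using assms
proof (induction p rule: trigpoly.induct)
  case (mono c m)
  show ?case by (rule exI[of _ "{- m}"], rule exI[of _ "\<lambda>_. c"]) simp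
next
  case (add p q)
  then obtain K c L d where K: "finite K" "p = (\<lambda>x. \<Sum>m\<in>K. c m * fourier_char (- m) x)"
    and L: "finite L" "q = (\<lambda>x. \<Sum>m\<in>L. d m * fourier_char (- m) x)" by blast
  let ?e = "\<lambda>m. (if m \<in> K then c m else 0) + (if m \<in> L then d m else 0)"
  have "(\<Sum>m\<in>K. c m * fourier_char (- m) x) = (\<Sum>m\<in>K \<union> L. (if m \<in> K then c m else 0) * fourier_char (- m) x)" for x
    using K(1) L(1) by (intro sum.mono_neutral_cong_left) auto
  moreover have "(\<Sum>m\<in>L. d m * fourier_char (- m) x) = (\<Sum>m\<in>K \<union> L. (if m \<in> L then d m else 0) * fourier_char (- m) x)" for x
    using K(1) L(1) by (intro sum.mono_neutral_cong_left) auto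
  ultimately have "(\<lambda>x. p x + q x) = (\<lambda>x. \<Sum>m\<in>K \<union> L. ?e m * fourier_char (- m) x)"
    by (simp add: K(2) L(2) distrib_right sum.distrib)
  then show ?case using K(1) L(1)
    by (intro exI[of _ "K \<union> L"] exI[of _ ?e]) auto
qed

text \<open>On the unit circle \<open>Re z\<close> and \<open>Im z\<close> are combinations of
  \<open>z\<close> and its conjugate, that is of the characters of index 1 and -1; sums and products
  of these stay trigonometric.\<close>

lemma trigpoly_real_polynomial:
  assumes "real_polynomial_function (p :: complex \<Rightarrow> real)"
  shows "trigpoly (\<lambda>x. of_real (p (fourier_char 1 x)))"
  using assms
proof (induction p rule: real_polynomial_function.induct)
  case (linear f)
  interpret f: bounded_linear f by fact
  have f: "f z = Re z * f 1 + Im z * f \<i>" for z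
  proof -
    have "f z = f (Re z *\<^sub>R 1 + Im z *\<^sub>R \<i>)"
      by (rule arg_cong[where f = f]) (simp add: complex_eq_iff)
    also have "\<dots> = Re z * f 1 + Im z * f \<i>" by (simp only: f.add f.scaleR real_scaleR_def)
    finally show ?thesis .
  qed
  have "complex_of_real (f (fourier_char 1 x)) =
      (f 1 / 2 - \<i> * f \<i> / 2) * fourier_char 1 x + (f 1 / 2 + \<i> * f \<i> / 2) * fourier_char (- 1) x" for x
    unfolding f[of "fourier_char 1 x"] by (simp add: complex_eq_iff fourier_char_def) 
  then show ?case by (simp only:) (intro trigpoly.intros)
next
  case (const c)
  show ?case using trigpoly.mono[of "of_real c" 0] by simp
next
  case (add f g)
  then show ?case by (simp add: trigpoly.add)
next
  case (mult f g)
  then show ?case by (simp add: trigpoly_mult)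
qed

text \<open>Since \<open>u\<close> takes equal values at the ends, it descends to a continuous
  function \<open>v\<close> on the unit circle. Stone-Weierstrass approximates \<open>v\<close> by a
  polynomial in the coordinates, and composing with \<open>fourier_char 1\<close> returns to the
  interval.\<close>

lemma trigpoly_approx_loop:
  fixes u :: "real \<Rightarrow> complex"
  assumes u: "continuous_on {0..1} u" "u 0 = u 1" and e: "0 < e"
  shows "\<exists>q. trigpoly q \<and> (\<forall>x\<in>{0..<1}. norm (u x - q x) < e)"
proof -
  define v where "v = u \<circ> (\<lambda>z. Arg2pi z / (2 * pi))"
  \<comment> \<open>The trivial homotopy from the loop \<open>u\<close> to itself is transferred to
    circle maps; continuity of \<open>v\<close>, also across the jump of \<open>Arg2pi\<close>, is
    read off from the result.\<close>
  have "homotopic_loops UNIV u u"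
    using u by (simp add: homotopic_loops_refl path_def pathstart_def pathfinish_def)
  from homotopic_loops_imp_homotopic_circlemaps[OF this]
  have v: "continuous_on (sphere 0 1) v"
    unfolding v_def[symmetric] by (rule homotopic_with_imp_continuous[THEN conjunct1])
  obtain p where p: "polynomial_function p" "\<And>z. z \<in> sphere 0 1 \<Longrightarrow> norm (v z - p z) < e"
    using Stone_Weierstrass_polynomial_function[OF compact_sphere v e] by blast
  have "real_polynomial_function (Re \<circ> p)" "real_polynomial_function (Im \<circ> p)"
    using p(1) bounded_linear_Re bounded_linear_Im unfolding polynomial_function_def by blast+
  from this[THEN trigpoly_real_polynomial]
  have t: "trigpoly (\<lambda>x. of_real (Re (p (fourier_char 1 x))))" "trigpoly (\<lambda>x. of_real (Im (p (fourier_char 1 x))))"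
    by simp_all
  have "trigpoly (\<lambda>x. \<i>)" using trigpoly.mono[of \<i> 0] by simp
  from trigpoly.add[OF t(1) trigpoly_mult[OF this t(2)]]
  have "trigpoly (\<lambda>x. p (fourier_char 1 x))" by (simp flip: complex_eq)
  moreover have "norm (u x - p (fourier_char 1 x)) < e" if "x \<in> {0..<1}" for x
  proof -
    have "Arg2pi (fourier_char 1 x) = 2 * pi * x"
      by (rule Arg2pi_unique[of 1]) (use that in \<open>auto simp: fourier_char_def cis_conv_exp\<close>)
    then have "v (fourier_char 1 x) = u x" by (simp add: v_def)
    then show ?thesis using p(2)[of "fourier_char 1 x"] by simp
  qed
  ultimately show ?thesis by blast
qed

text \<open>Radial projection onto the disc of radius \<open>N\<close>, for \<open>N > 0\<close>;
  the formula with \<open>max\<close> makes its continuity evident.\<close>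

definition clip :: "real \<Rightarrow> complex \<Rightarrow> complex" where
  "clip N z = z /\<^sub>R max 1 (norm z / N)"

lemma norm_clip_le: "norm (clip N z) \<le> norm z"
proof -
  have "norm (clip N z) = norm z / max 1 (norm z / N)"
    by (simp add: clip_def divide_inverse_commute)
  also have "\<dots> \<le> norm z / 1" by (intro divide_left_mono) auto
  finally show ?thesis by simp
qed

lemma norm_clip_bound:
  assumes "N > 0" shows "norm (clip N z) \<le> N"
proof -
  have "norm (clip N z) = norm z / max 1 (norm z / N)"
    by (simp add: clip_def divide_inverse_commute)
  also have "\<dots> \<le> N"
    using assms by (simp add: divide_le_eq max_def field_simps)
  finally show ?thesis .
qed

lemma clip_id: "N > 0 \<Longrightarrow> norm z \<le> N \<Longrightarrow> clip N z = z"
  by (simp add: clip_def max_def field_simps)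

lemma continuous_on_clip [continuous_intros]:
  assumes "N > 0" "continuous_on S f" shows "continuous_on S (\<lambda>x. clip N (f x))"
  unfolding clip_def using assms by (intro continuous_intros) auto

lemma clip_measurable [measurable]: "clip N \<in> borel_measurable borel"
  unfolding clip_def by measurable

lemma clip_tendsto:
  assumes "N > 0" "(f \<longlongrightarrow> l) Fl" shows "((\<lambda>x. clip N (f x)) \<longlongrightarrow> clip N l) Fl"
  unfolding clip_def using assms by (intro tendsto_intros) auto

text \<open>For each \<open>x\<close> the truncation at level \<open>Suc n\<close> is eventually
  inactive, and the squared error is dominated by \<open>4 * (norm (F x))\<^sup>2\<close>.\<close>

lemma clip_approx:
  assumes F: "sqint circle_measure F" and e: "0 < e"
  shows "\<exists>N>0. (\<integral>x. (norm (F x - clip N (F x)))\<^sup>2 \<partial>circle_measure) < e"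
proof -
  have [measurable]: "F \<in> borel_measurable circle_measure" using F by (simp add: sqint_def)
  have "(\<lambda>n. \<integral>x. (norm (F x - clip (Suc n) (F x)))\<^sup>2 \<partial>circle_measure) \<longlonglongrightarrow> (\<integral>x. 0 \<partial>circle_measure)"
  proof (rule integral_dominated_convergence)
    show "integrable circle_measure (\<lambda>x. 4 * (norm (F x))\<^sup>2)" using F by (simp add: sqint_def)
    show "AE x in circle_measure. (\<lambda>n. (norm (F x - clip (Suc n) (F x)))\<^sup>2) \<longlonglongrightarrow> 0"
    proof (intro AE_I2)
      fix x
      have "eventually (\<lambda>n. norm (F x) \<le> real n) sequentially"
        by (rule eventually_sequentiallyI[of "nat \<lceil>norm (F x)\<rceil>"]) linarith
      then have "eventually (\<lambda>n. (norm (F x - clip (Suc n) (F x)))\<^sup>2 = 0) sequentially"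
        by eventually_elim (simp add: clip_id)
      then show "(\<lambda>n. (norm (F x - clip (Suc n) (F x)))\<^sup>2) \<longlonglongrightarrow> 0"
        by (rule tendsto_eventually)
    qed
    have "(norm (F x - clip (Suc n) (F x)))\<^sup>2 \<le> 4 * (norm (F x))\<^sup>2" for n x
    proof -
      have "norm (F x - clip (Suc n) (F x)) \<le> 2 * norm (F x)"
        using norm_triangle_ineq4[of "F x" "clip (Suc n) (F x)"] norm_clip_le[of "real (Suc n)" "F x"]
        by linarith
      from power_mono[OF this norm_ge_zero, of 2] show ?thesis by (simp add: power_mult_distrib)
    qed
    then show "AE x in circle_measure. norm ((norm (F x - clip (Suc n) (F x)))\<^sup>2) \<le> 4 * (norm (F x))\<^sup>2" for n
      by simp
  qed measurable
  then have "eventually (\<lambda>n. (\<integral>x. (norm (F x - clip (Suc n) (F x)))\<^sup>2 \<partial>circle_measure) < e) sequentially"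
    using e by (intro order_tendstoD(2)) auto
  then obtain n where "(\<integral>x. (norm (F x - clip (Suc n) (F x)))\<^sup>2 \<partial>circle_measure) < e"
    by (auto simp: eventually_sequentially)
  then show ?thesis by (intro exI[of _ "real (Suc n)"]) simp
qed

lemma AE_circle_lborel:
  assumes "AE x in lborel. x \<in> {0..<1} \<longrightarrow> P x" shows "AE x in circle_measure. P x"
  using assms unfolding circle_measure_def by (subst AE_restrict_space_iff) auto

text \<open>A measurable function is an almost everywhere limit of continuous functions
  \<open>g n\<close>. Truncation at \<open>N\<close> gives a constant majorant, and a cut-off
  vanishing at 0 and 1 forces equal end values.\<close>

lemma bounded_approx_loop:
  fixes F :: "real \<Rightarrow> complex"
  assumes F: "F \<in> borel_measurable circle_measure" and N: "N > 0" "\<And>x. norm (F x) \<le> N" and e: "0 < e"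
  shows "\<exists>u. continuous_on UNIV u \<and> u 0 = u 1 \<and> (\<integral>x. (norm (F x - u x))\<^sup>2 \<partial>circle_measure) < e"
proof -
  define G where "G = (\<lambda>x. indicator {0..<1} x *\<^sub>R F x)"
  have "F \<in> borel_measurable (restrict_space borel {0..<1})"
    using F by (simp cong: measurable_cong_sets add: sets_circle)
  then have "G \<in> borel_measurable borel"
    unfolding G_def by (subst (asm) borel_measurable_restrict_space_iff) auto
  then have "G \<in> borel_measurable lborel" by simp
  then have "G \<in> borel_measurable lebesgue"
    by (rule measurable_completion)
  then have "G measurable_on UNIV"
    by (rule lebesgue_measurable_imp_measurable_on) simp
  then obtain Z g where Z: "negligible Z" and cont: "\<And>n. continuous_on UNIV (g n)"
    and lim: "\<And>x. x \<notin> Z \<Longrightarrow> (\<lambda>n. g n x) \<longlonglongrightarrow> G x"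
    unfolding measurable_on_def by auto
  \<comment> \<open>The bump vanishes at both ends and equals 1 at an interior \<open>x\<close> once
    \<open>n * (x * (1 - x)) \<ge> 1\<close>, so it leaves the pointwise limit inside
    unchanged.\<close>
  define ch :: "nat \<Rightarrow> real \<Rightarrow> real" where "ch n x = max 0 (min 1 (n * (x * (1 - x))))" for n x
  define u where "u n x = ch n x *\<^sub>R clip N (g n x)" for n x
  have cu: "continuous_on UNIV (u n)" for n
    unfolding u_def ch_def by (intro continuous_intros cont N(1))
  have [measurable]: "u n \<in> borel_measurable circle_measure" for n
    by (intro borel_measurable_circle borel_measurable_continuous_onI cu)
  note [measurable] = F
  have AEZ: "AE x in lborel. x \<notin> Z"
    using Z by (auto simp: negligible_iff_null_sets AE_completion_iff dest: AE_not_in)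
  have "(\<lambda>n. \<integral>x. (norm (F x - u n x))\<^sup>2 \<partial>circle_measure) \<longlonglongrightarrow> (\<integral>x. 0 \<partial>circle_measure)"
  proof (rule integral_dominated_convergence)
    show "integrable circle_measure (\<lambda>x. (2 * N)\<^sup>2)" by simp
    show "AE x in circle_measure. (\<lambda>n. (norm (F x - u n x))\<^sup>2) \<longlonglongrightarrow> 0"
    proof (rule AE_circle_lborel)
      show "AE x in lborel. x \<in> {0..<1} \<longrightarrow> (\<lambda>n. (norm (F x - u n x))\<^sup>2) \<longlonglongrightarrow> 0"
        using AEZ AE_lborel_singleton[of 0]
      proof eventually_elim
        case (elim x)
        show ?case
        proof
          assume x01: "x \<in> {0..<1}"
          with elim have x: "0 < x" "x < 1" by auto
          have "(\<lambda>n. ch n x) \<longlonglongrightarrow> 1"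
          proof (rule tendsto_eventually)
            have "eventually (\<lambda>n. 1 / (x * (1 - x)) \<le> real n) sequentially"
              by (rule eventually_sequentiallyI[of "nat \<lceil>1 / (x * (1 - x))\<rceil>"]) linarith
            then show "eventually (\<lambda>n. ch n x = 1) sequentially"
              by eventually_elim (use x in \<open>simp add: ch_def field_simps\<close>)
          qed
          moreover have "(\<lambda>n. clip N (g n x)) \<longlonglongrightarrow> clip N (F x)"
            using lim[OF elim(1)] x01 N by (intro clip_tendsto) (auto simp: G_def)
          ultimately have "(\<lambda>n. u n x) \<longlonglongrightarrow> 1 *\<^sub>R clip N (F x)"
            unfolding u_def by (intro tendsto_intros)
          then have "(\<lambda>n. u n x) \<longlonglongrightarrow> F x" using N by (simp add: clip_id)
          then have "(\<lambda>n. (norm (F x - u n x))\<^sup>2) \<longlonglongrightarrow> (norm (F x - F x))\<^sup>2"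
            by (intro tendsto_intros)
          then show "(\<lambda>n. (norm (F x - u n x))\<^sup>2) \<longlonglongrightarrow> 0" by simp
        qed
      qed
    qed
    have "(norm (F x - u n x))\<^sup>2 \<le> (2 * N)\<^sup>2" for n x
    proof (rule power_mono)
      have "norm (u n x) = ch n x * norm (clip N (g n x))" by (simp add: u_def ch_def)
      also have "\<dots> \<le> 1 * N" using N(1) by (intro mult_mono norm_clip_bound) (auto simp: ch_def)
      finally show "norm (F x - u n x) \<le> 2 * N"
        using norm_triangle_ineq4[of "F x" "u n x"] N(2)[of x] by linarith
    qed simp
    then show "AE x in circle_measure. norm ((norm (F x - u n x))\<^sup>2) \<le> (2 * N)\<^sup>2" for n by simp
  qed measurable
  then have "eventually (\<lambda>n. (\<integral>x. (norm (F x - u n x))\<^sup>2 \<partial>circle_measure) < e) sequentially"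
    using e by (intro order_tendstoD(2)) auto
  then obtain n where "(\<integral>x. (norm (F x - u n x))\<^sup>2 \<partial>circle_measure) < e"
    by (auto simp: eventually_sequentially)
  moreover have "u n 0 = u n 1" by (simp add: u_def ch_def)
  ultimately show ?thesis using cu by blast
qed

lemma sqint_continuous:
  assumes "continuous_on UNIV (u :: real \<Rightarrow> complex)" shows "sqint circle_measure u"
  unfolding sqint_def
proof (intro conjI)
  show m: "u \<in> borel_measurable circle_measure"
    by (intro borel_measurable_circle borel_measurable_continuous_onI assms)
  have "bounded (u ` {0..1})"
    using assms by (intro compact_imp_bounded compact_continuous_image) (auto intro: continuous_on_subset)
  then obtain B where B: "\<And>x. x \<in> {0..1} \<Longrightarrow> norm (u x) \<le> B" unfolding bounded_iff by blast
  show "integrable circle_measure (\<lambda>x. (norm (u x))\<^sup>2)"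
  proof (rule circle_measure.integrable_const_bound)
    show "AE x in circle_measure. norm ((norm (u x))\<^sup>2) \<le> B\<^sup>2"
      by (intro AE_I2) (auto intro!: power_mono B)
  qed (use m in measurable)
qed

lemma integral_norm_diff_triangle:
  assumes "sqint circle_measure F" "sqint circle_measure G" "sqint circle_measure H"
  shows "(\<integral>x. (norm (F x - H x))\<^sup>2 \<partial>circle_measure)
    \<le> 2 * (\<integral>x. (norm (F x - G x))\<^sup>2 \<partial>circle_measure) + 2 * (\<integral>x. (norm (G x - H x))\<^sup>2 \<partial>circle_measure)"
proof -
  have i: "integrable circle_measure (\<lambda>x. (norm (F x - G x))\<^sup>2)" "integrable circle_measure (\<lambda>x. (norm (G x - H x))\<^sup>2)"
    "integrable circle_measure (\<lambda>x. (norm (F x - H x))\<^sup>2)"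
    using sqint_diff[OF assms(1,2)] sqint_diff[OF assms(2,3)] sqint_diff[OF assms(1,3)]
    by (simp_all add: sqint_def)
  have "(\<integral>x. (norm (F x - H x))\<^sup>2 \<partial>circle_measure)
    \<le> (\<integral>x. 2 * (norm (F x - G x))\<^sup>2 + 2 * (norm (G x - H x))\<^sup>2 \<partial>circle_measure)"
  proof (rule integral_mono)
    fix x
    show "(norm (F x - H x))\<^sup>2 \<le> 2 * (norm (F x - G x))\<^sup>2 + 2 * (norm (G x - H x))\<^sup>2"
      using norm_add_sq_le[of "F x - G x" "G x - H x"] by simp
  qed (use i in simp_all)
  then show ?thesis using i by simp
qed

lemma trigpoly_continuous: "trigpoly p \<Longrightarrow> continuous_on UNIV p"
  by (induction rule: trigpoly.induct)
     (auto simp: fourier_char_def cis_conv_exp intro!: continuous_intros)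

lemma trigpoly_dense:
  assumes F: "sqint circle_measure F" and e: "0 < e"
  shows "\<exists>q. trigpoly q \<and> (\<integral>x. (norm (F x - q x))\<^sup>2 \<partial>circle_measure) < e"
proof -
  \<comment> \<open>Three squared errors, from truncation, continuous approximation and
    trigonometric approximation, are each at most \<open>e / 16\<close>. Two uses of
    \<open>integral_norm_diff_triangle\<close> weight them by 2, 4 and 4, so the total is at most
    \<open>10 * e / 16\<close>.\<close>
  obtain N where N: "N > 0" "(\<integral>x. (norm (F x - clip N (F x)))\<^sup>2 \<partial>circle_measure) < e / 16"
    using clip_approx[OF F, of "e / 16"] e by auto
  let ?G = "\<lambda>x. clip N (F x)"
  have mF: "F \<in> borel_measurable circle_measure" using F by (simp add: sqint_def)
  then have mG: "?G \<in> borel_measurable circle_measure" by measurable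
  have G: "sqint circle_measure ?G" by (rule sqint_bound[OF mG F, of 1]) (simp add: norm_clip_le)
  obtain u where u: "continuous_on UNIV u" "u 0 = u 1" "(\<integral>x. (norm (?G x - u x))\<^sup>2 \<partial>circle_measure) < e / 16"
    using bounded_approx_loop[OF mG N(1) norm_clip_bound[OF N(1)], of "e / 16"] e by auto
  obtain q where q: "trigpoly q" "\<And>x. x \<in> {0..<1} \<Longrightarrow> norm (u x - q x) < sqrt (e / 16)"
    using trigpoly_approx_loop[of u "sqrt (e / 16)"] continuous_on_subset[OF u(1) subset_UNIV] u(2) e by auto
  have su: "sqint circle_measure u" by (rule sqint_continuous) fact
  have sq: "sqint circle_measure q" by (rule sqint_continuous) (rule trigpoly_continuous, fact)
  have "(\<integral>x. (norm (u x - q x))\<^sup>2 \<partial>circle_measure) \<le> (\<integral>x. e / 16 \<partial>circle_measure)"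
  proof (rule integral_mono)
    show "integrable circle_measure (\<lambda>x. (norm (u x - q x))\<^sup>2)"
      using sqint_diff[OF su sq] by (simp add: sqint_def)
    fix x assume "x \<in> space circle_measure"
    then have "norm (u x - q x) \<le> sqrt (e / 16)" using q(2)[of x] by simp
    from power_mono[OF this norm_ge_zero, of 2] e show "(norm (u x - q x))\<^sup>2 \<le> e / 16" by simp
  qed simp
  then have "(\<integral>x. (norm (u x - q x))\<^sup>2 \<partial>circle_measure) \<le> e / 16" by simp
  then have "(\<integral>x. (norm (F x - q x))\<^sup>2 \<partial>circle_measure) < e"
    using N(2) u(3) integral_norm_diff_triangle[OF F G sq] integral_norm_diff_triangle[OF G su sq] e by linarith
  then show ?thesis using q(1) by blast
qed

section \<open>Bessel's inequality and Parseval's identity\<close>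

lemma bessel:
  assumes F: "sqint circle_measure F" and "finite K"
  shows "(\<Sum>m\<in>K. (norm (fourier_coeff F m))\<^sup>2) \<le> (\<integral>x. (norm (F x))\<^sup>2 \<partial>circle_measure)"
proof -
  have "0 \<le> (\<integral>x. (norm (F x - (\<Sum>m\<in>K. fourier_coeff F m * fourier_char (- m) x)))\<^sup>2 \<partial>circle_measure)" by simp
  then show ?thesis unfolding integral_norm_diff_trig[OF assms] by simp
qed

text \<open>Bessel bounds every finite sum. Conversely, a trigonometric polynomial with frequencies
  in \<open>K\<close> has squared error at least the integral minus the sum over \<open>K\<close>,
  and density makes that error arbitrarily small.\<close>

lemma parseval_circle:
  assumes F: "sqint circle_measure F"
  shows "((\<lambda>m. (norm (fourier_coeff F m))\<^sup>2) has_sum (\<integral>x. (norm (F x))\<^sup>2 \<partial>circle_measure)) UNIV"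
proof -
  let ?I = "\<integral>x. (norm (F x))\<^sup>2 \<partial>circle_measure"
  have s: "(\<lambda>m. (norm (fourier_coeff F m))\<^sup>2) summable_on UNIV"
    by (rule nonneg_bdd_above_summable_on)
       (use bessel[OF F] in \<open>auto intro!: bdd_aboveI[of _ ?I]\<close>)
  have "infsum (\<lambda>m. (norm (fourier_coeff F m))\<^sup>2) UNIV \<le> ?I"
    by (rule infsum_le_finite_sums[OF s]) (use bessel[OF F] in auto)
  moreover have "?I \<le> infsum (\<lambda>m. (norm (fourier_coeff F m))\<^sup>2) UNIV"
  proof (rule field_le_epsilon)
    fix e :: real assume "0 < e"
    from trigpoly_dense[OF F this] obtain q where q: "trigpoly q" "(\<integral>x. (norm (F x - q x))\<^sup>2 \<partial>circle_measure) < e"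
      by blast
    from trigpoly_sum[OF q(1)] obtain K c where K: "finite K" "q = (\<lambda>x. \<Sum>m\<in>K. c m * fourier_char (- m) x)"
      by blast
    have 1: "?I - (\<Sum>m\<in>K. (norm (fourier_coeff F m))\<^sup>2) \<le> (\<integral>x. (norm (F x - q x))\<^sup>2 \<partial>circle_measure)"
      unfolding K(2) integral_norm_diff_trig[OF F K(1)] by (simp add: sum_nonneg)
    have 2: "(\<Sum>m\<in>K. (norm (fourier_coeff F m))\<^sup>2) \<le> infsum (\<lambda>m. (norm (fourier_coeff F m))\<^sup>2) UNIV"
      by (rule finite_sum_le_infsum[OF s K(1)]) auto
    from 1 2 q(2) show "?I \<le> infsum (\<lambda>m. (norm (fourier_coeff F m))\<^sup>2) UNIV + e" by linarith
  qed
  ultimately have "infsum (\<lambda>m. (norm (fourier_coeff F m))\<^sup>2) UNIV = ?I" by (rule order_antisym)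
  then show ?thesis using has_sum_infsum[OF s] by simp
qed

subsection \<open>The fibre matrices\<close>

text \<open>Series of nonnegative terms are handled as integrals against counting measure, so that
  Tonelli can interchange them with other sums and integrals.\<close>

lemma nn_integral_count_space_has_sum:
  assumes "(f has_sum s) A" "\<And>x. x \<in> A \<Longrightarrow> 0 \<le> f x"
  shows "(\<integral>\<^sup>+x. ennreal (f x) \<partial>count_space A) = ennreal s"
proof -
  have "f summable_on A" "infsum f A = s" using assms(1) by (auto simp: summable_on_def infsumI)
  moreover from this assms(2) have "Infinite_Set_Sum.abs_summable_on f A"
    by (simp flip: abs_summable_equivalent cong: summable_on_cong)
  ultimately show ?thesis
    using nn_integral_conv_infsetsum[of f A] assms(2) by (simp add: infsetsum_infsum)
qed

lemma has_sum_nn_integral_count_space: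
  assumes "(\<integral>\<^sup>+x. ennreal (f x) \<partial>count_space A) = ennreal s" "\<And>x. x \<in> A \<Longrightarrow> 0 \<le> f x" "0 \<le> s"
  shows "(f has_sum s) A"
proof -
  have "Infinite_Set_Sum.abs_summable_on f A"
    unfolding abs_summable_on_def using assms by (intro integrableI_nonneg) (auto simp: AE_count_space)
  moreover from this have s: "f summable_on A"
    using assms(2) by (simp flip: abs_summable_equivalent cong: summable_on_cong)
  ultimately have "infsum f A = s"
    using nn_integral_conv_infsetsum[of f A] assms infsum_nonneg[of A f] by (simp add: infsetsum_infsum)
  then show ?thesis using has_sum_infsum[OF s] by simp
qed

text \<open>Used with spacing \<open>a\<close> to count rows and spacing 1 to count columns; the
  count is uniform in \<open>y\<close>.\<close>

lemma card_int_progression: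
  fixes a T y :: real
  assumes "a > 0" "T \<ge> 0"
  shows "finite {n :: int. \<bar>y - of_int n * a\<bar> \<le> T}"
    and "real (card {n :: int. \<bar>y - of_int n * a\<bar> \<le> T}) \<le> 2 * T / a + 1"
proof -
  let ?l = "\<lceil>(y - T) / a\<rceil>" and ?u = "\<lfloor>(y + T) / a\<rfloor>"
  have sub: "{n :: int. \<bar>y - of_int n * a\<bar> \<le> T} \<subseteq> {?l..?u}"
    using assms(1) by (auto simp: ceiling_le_iff le_floor_iff divide_le_eq le_divide_eq abs_le_iff)
  then show "finite {n :: int. \<bar>y - of_int n * a\<bar> \<le> T}" by (rule finite_subset) simp
  have "real (card {n :: int. \<bar>y - of_int n * a\<bar> \<le> T}) \<le> real (card {?l..?u})"
    using card_mono[OF _ sub] by simp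
  also have "\<dots> = real (nat (?u + 1 - ?l))" by simp
  also have "\<dots> \<le> 2 * T / a + 1"
  proof -
    have "real_of_int ?u \<le> (y + T) / a" "(y - T) / a \<le> real_of_int ?l" by linarith+
    moreover have "(y + T) / a - (y - T) / a = 2 * T / a" by (simp add: diff_divide_distrib[symmetric])
    moreover have "0 \<le> 2 * T / a" using assms by simp
    ultimately show ?thesis by (cases "0 \<le> ?u + 1 - ?l") (simp_all, linarith?)
  qed
  finally show "real (card {n :: int. \<bar>y - of_int n * a\<bar> \<le> T}) \<le> 2 * T / a + 1" .
qed

text \<open>For \<open>k\<close> of bounded support the sum is finite; \<open>n\<close> indexes the rows and \<open>j\<close> the columns.\<close>

definition gabor_fibre :: "real \<Rightarrow> (real \<Rightarrow> complex) \<Rightarrow> real \<Rightarrow> (int \<Rightarrow> complex) \<Rightarrow> int \<Rightarrow> complex" where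
  "gabor_fibre a k x c n = (\<Sum>\<^sub>\<infinity>j. c j * k (x + of_int j - of_int n * a))"

text \<open>The squared l2 norm, valued in \<open>ennreal\<close> so that no summability has to be
  tracked.\<close>

definition sqnorm :: "(int \<Rightarrow> complex) \<Rightarrow> ennreal" where
  "sqnorm c = (\<integral>\<^sup>+j. ennreal ((norm (c j))\<^sup>2) \<partial>count_space UNIV)"

lemma gabor_fibre_eq_sum:
  assumes "finite J" "\<And>j. j \<notin> J \<Longrightarrow> c j * k (x + of_int j - of_int n * a) = 0"
  shows "gabor_fibre a k x c n = (\<Sum>j\<in>J. c j * k (x + of_int j - of_int n * a))"
proof -
  have "gabor_fibre a k x c n = infsum (\<lambda>j. c j * k (x + of_int j - of_int n * a)) J"
    unfolding gabor_fibre_def by (rule infsum_cong_neutral) (use assms(2) in auto)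
  then show ?thesis using assms(1) by simp
qed

text \<open>\<open>infsum\<close> is 0 on divergent series, so the value of
  \<open>gabor_fibre\<close> alone does not certify convergence; bounded support makes the sum
  finite. This links the vanishing series of the theorem to a vanishing fibre.\<close>

lemma has_sum_gabor_fibre:
  assumes "\<And>t. \<bar>t\<bar> > S \<Longrightarrow> k t = 0"
  shows "((\<lambda>j. c j * k (x + of_int j - of_int n * a)) has_sum gabor_fibre a k x c n) UNIV"
proof -
  let ?J = "{j :: int. \<bar>(of_int n * a - x) - of_int j * 1\<bar> \<le> max S 0}"
  have J: "finite ?J" by (rule card_int_progression) auto
  have 0: "c j * k (x + of_int j - of_int n * a) = 0" if "j \<notin> ?J" for j
    using that by (intro mult_zero_right[THEN trans[rotated]] arg_cong2[where f = "(*)"] refl assms) auto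
  have "((\<lambda>j. c j * k (x + of_int j - of_int n * a)) has_sum (\<Sum>j\<in>?J. c j * k (x + of_int j - of_int n * a))) UNIV"
    by (rule has_sum_finite_neutralI) (use J 0 in auto)
  then show ?thesis using gabor_fibre_eq_sum[of ?J c k x n a] J 0 by simp
qed

text \<open>Moving the base point by \<open>p - m a\<close> renumbers columns by \<open>p\<close>
  and rows by \<open>m\<close>. This recentres any index at 0 and brings any base point into
  \<open>[0, a]\<close>.\<close>

lemma gabor_fibre_shift:
  "gabor_fibre a k (x + of_int p - of_int m * a) (\<lambda>j. c (j + p)) n = gabor_fibre a k x c (n + m)"
  unfolding gabor_fibre_def
  by (rule infsum_reindex_bij_witness[of _ "\<lambda>j. j - p" "\<lambda>j. j + p"]) (auto simp: algebra_simps)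

lemma gabor_fibre_scale: "gabor_fibre a k x (\<lambda>j. z * c j) n = z * gabor_fibre a k x c n"
  unfolding gabor_fibre_def mult.assoc by (rule infsum_cmult_right')

lemma sqnorm_reindex: "bij g \<Longrightarrow> sqnorm (\<lambda>j. c (g j)) = sqnorm c"
  unfolding sqnorm_def by (rule nn_integral_bij_count_space)

text \<open>Schur's test for a band matrix: a row meets at most \<open>2 * S + 1\<close> columns, a
  column at most \<open>2 * S / a + 1\<close> rows, and entries are bounded by \<open>M\<close>.
  Cauchy-Schwarz treats the rows; interchanging the sums treats the columns.\<close>

lemma sqnorm_gabor_fibre_le:
  assumes a: "a > 0" and S: "S \<ge> 0" and kS: "\<And>t. \<bar>t\<bar> > S \<Longrightarrow> k t = 0" and kM: "\<And>t. norm (k t) \<le> M"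
  shows "sqnorm (gabor_fibre a k x c) \<le> ennreal ((2 * S + 1) * M\<^sup>2 * (2 * S / a + 1)) * sqnorm c"
proof -
  have M: "M \<ge> 0" using norm_ge_zero kM order_trans by blast
  define J where "J n = {j :: int. \<bar>(of_int n * a - x) - of_int j * 1\<bar> \<le> S}" for n :: int
  have finJ: "finite (J n)" and cardJ: "real (card (J n)) \<le> 2 * S + 1" for n
    unfolding J_def using card_int_progression[of 1 S "of_int n * a - x"] S by auto
  define C where "C = (2 * S + 1) * M\<^sup>2"
  have C: "C \<ge> 0" unfolding C_def using S by simp
  have "ennreal ((norm (gabor_fibre a k x c n))\<^sup>2)
     \<le> (\<integral>\<^sup>+j. ennreal C * (ennreal ((norm (c j))\<^sup>2) * indicator (J n) j) \<partial>count_space UNIV)" for n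
  proof -
    have "gabor_fibre a k x c n = (\<Sum>j\<in>J n. c j * k (x + of_int j - of_int n * a))"
      by (rule gabor_fibre_eq_sum[OF finJ]) (use kS in \<open>auto simp: J_def\<close>)
    then have "norm (gabor_fibre a k x c n) \<le> (\<Sum>j\<in>J n. norm (c j) * M)"
      by (auto intro!: sum_norm_le mult_left_mono kM simp: norm_mult)
    then have "(norm (gabor_fibre a k x c n))\<^sup>2 \<le> (\<Sum>j\<in>J n. norm (c j) * M)\<^sup>2"
      by (intro power_mono) auto
    also have "\<dots> \<le> (\<Sum>j\<in>J n. (norm (c j))\<^sup>2) * (\<Sum>j\<in>J n. M\<^sup>2)"
      by (rule Cauchy_Schwarz_ineq_sum)
    also have "\<dots> \<le> (\<Sum>j\<in>J n. (norm (c j))\<^sup>2) * C"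
      unfolding C_def using cardJ[of n] by (intro mult_left_mono) (auto intro: mult_right_mono sum_nonneg)
    finally have "ennreal ((norm (gabor_fibre a k x c n))\<^sup>2) \<le> ennreal ((\<Sum>j\<in>J n. (norm (c j))\<^sup>2) * C)"
      by (rule ennreal_leI)
    also have "\<dots> = ennreal C * (\<Sum>j\<in>J n. ennreal ((norm (c j))\<^sup>2))"
      using C by (simp add: ennreal_mult sum_nonneg mult.commute)
    also have "(\<Sum>j\<in>J n. ennreal ((norm (c j))\<^sup>2)) = (\<integral>\<^sup>+j. ennreal ((norm (c j))\<^sup>2) * indicator (J n) j \<partial>count_space UNIV)"
      by (subst nn_integral_count_space'[OF finJ[of n]]) auto
    finally show ?thesis by (simp add: nn_integral_cmult)
  qed
  then have "sqnorm (gabor_fibre a k x c)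
     \<le> (\<integral>\<^sup>+n. \<integral>\<^sup>+j. ennreal C * (ennreal ((norm (c j))\<^sup>2) * indicator (J n) j) \<partial>count_space UNIV \<partial>count_space UNIV)"
    unfolding sqnorm_def by (intro nn_integral_mono)
  also have "\<dots> = (\<integral>\<^sup>+j. \<integral>\<^sup>+n. ennreal C * (ennreal ((norm (c j))\<^sup>2) * indicator (J n) j) \<partial>count_space UNIV \<partial>count_space UNIV)"
    by (rule nn_integral_count_space_nn_integral[symmetric]) auto
  also have "\<dots> \<le> (\<integral>\<^sup>+j. (ennreal C * ennreal (2 * S / a + 1)) * ennreal ((norm (c j))\<^sup>2) \<partial>count_space UNIV)"
  proof (intro nn_integral_mono)
    fix j :: int
    let ?N = "{n :: int. \<bar>(x + of_int j) - of_int n * a\<bar> \<le> S}"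
    have N: "indicator (J n) j = (indicator ?N n :: ennreal)" for n
      by (auto simp: J_def indicator_def abs_le_iff)
    have "(\<integral>\<^sup>+n. indicator (J n) j \<partial>count_space UNIV) = of_nat (card ?N)"
      unfolding N using card_int_progression(1)[OF a S, of "x + of_int j"] by (simp add: emeasure_count_space_finite)
    also have "\<dots> \<le> ennreal (2 * S / a + 1)"
      using card_int_progression(2)[OF a S, of "x + of_int j"] by (simp add: ennreal_of_nat_eq_real_of_nat ennreal_leI)
    finally have "(\<integral>\<^sup>+n. indicator (J n) j \<partial>count_space UNIV) \<le> ennreal (2 * S / a + 1)" .
    then have "ennreal C * (ennreal ((norm (c j))\<^sup>2) * (\<integral>\<^sup>+n. indicator (J n) j \<partial>count_space UNIV))
        \<le> ennreal C * (ennreal ((norm (c j))\<^sup>2) * ennreal (2 * S / a + 1))"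
      by (intro mult_left_mono) auto
    moreover have "(\<integral>\<^sup>+n. ennreal C * (ennreal ((norm (c j))\<^sup>2) * indicator (J n) j) \<partial>count_space UNIV)
        = ennreal C * (ennreal ((norm (c j))\<^sup>2) * (\<integral>\<^sup>+n. indicator (J n) j \<partial>count_space UNIV))"
      by (simp add: nn_integral_cmult)
    ultimately show "(\<integral>\<^sup>+n. ennreal C * (ennreal ((norm (c j))\<^sup>2) * indicator (J n) j) \<partial>count_space UNIV)
        \<le> (ennreal C * ennreal (2 * S / a + 1)) * ennreal ((norm (c j))\<^sup>2)"
      by (simp add: mult_ac)
  qed
  also have "\<dots> = (ennreal C * ennreal (2 * S / a + 1)) * sqnorm c"
    unfolding sqnorm_def by (simp add: nn_integral_cmult)
  also have "ennreal C * ennreal (2 * S / a + 1) = ennreal (C * (2 * S / a + 1))"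
    using C S a by (simp add: ennreal_mult)
  finally show ?thesis unfolding C_def .
qed

text \<open>Rounding \<open>y\<close> down changes the distance to \<open>i\<close> by at most 1 and
  costs a factor \<open>exp \<delta>\<close>; what remains is a two-sided geometric series. Real
  \<open>y\<close> are allowed because row positions need not be integers.\<close>

lemma exp_weight_bounded:
  assumes "\<delta> > 0"
  shows "\<exists>K>0. \<forall>y::real. (\<integral>\<^sup>+i. ennreal (exp (- \<delta> * \<bar>y - of_int i\<bar>)) \<partial>count_space (UNIV :: int set)) \<le> ennreal K"
proof -
  define f :: "int \<Rightarrow> real" where "f i = exp (- \<delta> * \<bar>of_int i\<bar>)" for i
  have geo: "(\<lambda>n::nat. exp (- \<delta>) ^ n) summable_on UNIV"
    using assms by (intro norm_summable_imp_summable_on) (auto simp: summable_geometric_iff)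
  have fn: "f (int n) = exp (- \<delta>) ^ n" "f (- int n) = exp (- \<delta>) ^ n" for n
    by (simp_all add: f_def exp_of_nat_mult[symmetric] mult.commute)
  have "f summable_on range int"
    by (subst summable_on_reindex) (auto simp: o_def fn geo)
  moreover have "f summable_on range (\<lambda>n. - int n)"
    by (subst summable_on_reindex) (auto simp: o_def fn geo inj_def)
  ultimately have "f summable_on (range int \<union> range (\<lambda>n. - int n))"
    by (rule summable_on_union)
  moreover have "range int \<union> range (\<lambda>n. - int n) = UNIV"
    by (auto simp: image_iff) (metis int_cases2)
  ultimately have "f summable_on UNIV" by simp
  then obtain s where s: "(f has_sum s) UNIV" unfolding summable_on_def by blast
  have fs: "(\<integral>\<^sup>+i. ennreal (f i) \<partial>count_space UNIV) = ennreal s"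
    by (rule nn_integral_count_space_has_sum[OF s]) (simp add: f_def)
  \<comment> \<open>\<open>max s 1\<close> makes the constant positive without a separate argument
    about \<open>s\<close>.\<close>
  have "(\<integral>\<^sup>+i. ennreal (exp (- \<delta> * \<bar>y - of_int i\<bar>)) \<partial>count_space (UNIV :: int set)) \<le> ennreal (exp \<delta> * max s 1)" for y
  proof -
    have "exp (- \<delta> * \<bar>y - of_int i\<bar>) \<le> exp \<delta> * f (\<lfloor>y\<rfloor> - i)" for i
    proof -
      have "\<bar>of_int (\<lfloor>y\<rfloor> - i)\<bar> \<le> \<bar>y - of_int i\<bar> + (1::real)" unfolding of_int_diff by linarith
      then have "\<delta> * \<bar>of_int (\<lfloor>y\<rfloor> - i)\<bar> \<le> \<delta> * (\<bar>y - of_int i\<bar> + 1)"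
        using assms by (intro mult_left_mono) auto
      then show ?thesis unfolding f_def exp_add[symmetric] by (simp add: algebra_simps)
    qed
    then have "(\<integral>\<^sup>+i. ennreal (exp (- \<delta> * \<bar>y - of_int i\<bar>)) \<partial>count_space (UNIV :: int set))
      \<le> (\<integral>\<^sup>+i. ennreal (exp \<delta> * f (\<lfloor>y\<rfloor> - i)) \<partial>count_space UNIV)"
      by (intro nn_integral_mono ennreal_leI)
    also have "\<dots> = (\<integral>\<^sup>+i. ennreal (exp \<delta> * f i) \<partial>count_space UNIV)"
      by (rule nn_integral_bij_count_space) (rule bij_betw_byWitness[where f' = "\<lambda>i. \<lfloor>y\<rfloor> - i"], auto)
    also have "\<dots> = ennreal (exp \<delta>) * ennreal s"
      by (simp add: ennreal_mult' nn_integral_cmult fs)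
    also have "\<dots> = ennreal (exp \<delta> * s)" by (simp add: ennreal_mult')
    also have "\<dots> \<le> ennreal (exp \<delta> * max s 1)" by (intro ennreal_leI mult_left_mono) auto
    finally show ?thesis .
  qed
  then show ?thesis by (intro exI[of _ "exp \<delta> * max s 1"]) auto
qed

subsection \<open>Injectivity on bounded sequences implies a uniform lower bound\<close>

text \<open>Turns smallness of a whole sum into pointwise control around one index.
  \<open>\<alpha> n\<close> is the position of row \<open>n\<close> on the column axis; averaging
  over all candidate centres costs only the constant \<open>K\<close>.\<close>

lemma weighted_selection:
  fixes u v :: "int \<Rightarrow> real" and \<alpha> :: "int \<Rightarrow> real"
  assumes u: "\<And>j. 0 \<le> u j" and v: "\<And>n. 0 \<le> v n" and d: "\<delta> > 0" and K: "K > 0" and A: "A > 0"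
    and wK: "\<And>y::real. (\<integral>\<^sup>+i. ennreal (exp (- \<delta> * \<bar>y - of_int i\<bar>)) \<partial>count_space (UNIV :: int set)) \<le> ennreal K"
    and ufin: "(\<integral>\<^sup>+j. ennreal (u j) \<partial>count_space UNIV) < \<infinity>"
    and less: "(\<integral>\<^sup>+n. ennreal (v n) \<partial>count_space UNIV) < ennreal A * (\<integral>\<^sup>+j. ennreal (u j) \<partial>count_space UNIV)"
  shows "\<exists>j0. 0 < u j0 \<and> (\<forall>j. u j \<le> 2 * u j0 * exp (\<delta> * \<bar>of_int j - of_int j0\<bar>)) \<and>
    (\<forall>n. v n \<le> A * K * u j0 * exp (\<delta> * \<bar>\<alpha> n - of_int j0\<bar>))"
proof -
  define w where "w y = exp (- \<delta> * \<bar>y\<bar>)" for y :: real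
  have w: "0 < w y" "w y \<le> 1" for y using d by (auto simp: w_def)
  have w0: "w 0 = 1" by (simp add: w_def)
  \<comment> \<open>This quotient bound later moves the weights from the centre \<open>i\<close> to
    the selected index \<open>j0\<close>.\<close>
  have w_tri: "w (z - i) / w (y - i) \<le> exp (\<delta> * \<bar>y - z\<bar>)" for y z i
  proof -
    have "w (z - i) / w (y - i) = exp (\<delta> * (\<bar>y - i\<bar> - \<bar>z - i\<bar>))"
      by (simp add: w_def exp_diff[symmetric] algebra_simps)
    also have "\<dots> \<le> exp (\<delta> * \<bar>y - z\<bar>)" using d by (auto intro!: mult_left_mono)
    finally show ?thesis .
  qed
  define m where "m i j = u j * w (of_int j - of_int i)" for i j :: int
  have m0: "0 \<le> m i j" for i j using u w by (simp add: m_def less_imp_le)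
  \<comment> \<open>The weighted maximum \<open>M\<close> and the weighted sum \<open>N\<close> satisfy \<open>\<Sum>i. N i < A K \<Sum>i. M i\<close>, which singles out
    a centre \<open>i\<close>; then \<open>j0\<close> is a near-maximiser for \<open>M i\<close>.\<close>
  define M where "M i = (SUP j. ennreal (m i j))" for i
  define N where "N i = (\<integral>\<^sup>+n. ennreal (v n * w (\<alpha> n - of_int i)) \<partial>count_space UNIV)" for i :: int
  let ?U = "\<integral>\<^sup>+j. ennreal (u j) \<partial>count_space UNIV"
  let ?V = "\<integral>\<^sup>+n. ennreal (v n) \<partial>count_space UNIV"
  have "(\<integral>\<^sup>+i. N i \<partial>count_space UNIV)
      = (\<integral>\<^sup>+n. \<integral>\<^sup>+i. ennreal (v n) * ennreal (w (\<alpha> n - of_int i)) \<partial>count_space (UNIV :: int set) \<partial>count_space UNIV)"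
    unfolding N_def using v by (subst nn_integral_count_space_nn_integral[symmetric]) (auto simp: ennreal_mult')
  also have "\<dots> \<le> (\<integral>\<^sup>+n. ennreal (v n) * ennreal K \<partial>count_space UNIV)"
    using wK unfolding w_def by (intro nn_integral_mono) (simp add: nn_integral_cmult mult_left_mono)
  also have "\<dots> = ?V * ennreal K" by (simp add: nn_integral_multc)
  also have "\<dots> < (ennreal A * ?U) * ennreal K"
    using K by (intro ennreal_mult_strict_right_mono less) auto
  also have "\<dots> = ennreal (A * K) * ?U" using A by (simp add: ennreal_mult' mult_ac)
  also have "?U \<le> (\<integral>\<^sup>+i. M i \<partial>count_space UNIV)"
  proof (rule nn_integral_mono)
    fix i show "ennreal (u i) \<le> M i"
      unfolding M_def by (rule SUP_upper2[of i]) (auto simp: m_def w0)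
  qed
  finally have "(\<integral>\<^sup>+i. N i \<partial>count_space UNIV) < ennreal (A * K) * (\<integral>\<^sup>+i. M i \<partial>count_space UNIV)"
    by (simp add: mult_left_mono)
  also have "\<dots> = (\<integral>\<^sup>+i. ennreal (A * K) * M i \<partial>count_space UNIV)" by (simp add: nn_integral_cmult)
  finally have "\<exists>i. N i < ennreal (A * K) * M i"
    using nn_integral_mono[of "count_space UNIV" "\<lambda>i. ennreal (A * K) * M i" N] by (meson leD leI)
  then obtain i where i: "N i < ennreal (A * K) * M i" ..
  \<comment> \<open>Finiteness and positivity of the supremum yield an index exceeding half of it,
    which avoids proving that it is attained.\<close>
  have "M i \<le> ?U"
    unfolding M_def
  proof (rule SUP_least)
    fix j
    have "ennreal (m i j) \<le> ennreal (u j)"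
      unfolding m_def using u w by (intro ennreal_leI) (simp add: mult_left_le)
    also have "\<dots> \<le> ?U" by (rule nn_integral_ge_point) simp
    finally show "ennreal (m i j) \<le> ?U" .
  qed
  with ufin obtain r where r: "M i = ennreal r" "0 \<le> r"
    by (metis ennreal_cases infinity_ennreal_def leD)
  have "M i \<noteq> 0" using i by auto
  with r have r0: "0 < r" by (metis ennreal_0 le_less)
  have "ennreal (r / 2) < M i" using r r0 by (simp add: ennreal_less_iff)
  then obtain j1 where j1: "ennreal (r / 2) < ennreal (m i j1)" unfolding M_def less_SUP_iff by blast
  have "ennreal (A * K) * M i = (SUP j. ennreal (A * K) * ennreal (m i j))"
    unfolding M_def by (rule SUP_mult_left_ennreal)
  with i obtain j2 where j2: "N i < ennreal (A * K) * ennreal (m i j2)" by (auto simp: less_SUP_iff)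
  \<comment> \<open>\<open>j1\<close> exceeds half the supremum and \<open>j2\<close> witnesses the
    strict inequality with \<open>N i\<close>; the one with the larger weighted value has both
    properties.\<close>
  define j0 where "j0 = (if m i j1 \<le> m i j2 then j2 else j1)"
  have "r / 2 < m i j1" using j1 r0 m0 by (simp add: ennreal_less_iff)
  then have j0r: "r / 2 < m i j0" unfolding j0_def by auto
  have "ennreal (A * K) * ennreal (m i j2) \<le> ennreal (A * K) * ennreal (m i j0)"
    unfolding j0_def by (intro mult_left_mono) (auto intro: ennreal_leI)
  with j2 have Ni: "N i < ennreal (A * K * m i j0)"
    using A K m0 by (simp add: ennreal_mult'[symmetric] less_le_trans)
  have "m i j0 > 0" using j0r r0 by linarith
  then have uj0: "u j0 > 0" using w[of "of_int j0 - of_int i"] by (simp add: m_def zero_less_mult_iff)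
  moreover have "u j \<le> 2 * u j0 * exp (\<delta> * \<bar>of_int j - of_int j0\<bar>)" for j
  proof -
    have "ennreal (m i j) \<le> M i" unfolding M_def by (rule SUP_upper) simp
    then have "m i j \<le> r" using r by simp
    then have "u j * w (of_int j - of_int i) \<le> 2 * u j0 * w (of_int j0 - of_int i)"
      using j0r by (simp add: m_def)
    then have "u j \<le> 2 * u j0 * (w (of_int j0 - of_int i) / w (of_int j - of_int i))"
      using w[of "of_int j - of_int i"] by (simp add: field_simps)
    also have "\<dots> \<le> 2 * u j0 * exp (\<delta> * \<bar>of_int j - of_int j0\<bar>)"
      using uj0 w_tri by (intro mult_left_mono) auto
    finally show ?thesis .
  qed
  moreover have "v n \<le> A * K * u j0 * exp (\<delta> * \<bar>\<alpha> n - of_int j0\<bar>)" for n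
  proof -
    have "ennreal (v n * w (\<alpha> n - of_int i)) \<le> N i" unfolding N_def by (rule nn_integral_ge_point) simp
    also note Ni
    finally have "v n * w (\<alpha> n - of_int i) < A * K * u j0 * w (of_int j0 - of_int i)"
      using v w by (simp add: ennreal_less_iff less_imp_le m_def mult_ac)
    then have "v n \<le> A * K * u j0 * (w (of_int j0 - of_int i) / w (\<alpha> n - of_int i))"
      using w[of "\<alpha> n - of_int i"] by (simp add: field_simps)
    also have "\<dots> \<le> A * K * u j0 * exp (\<delta> * \<bar>\<alpha> n - of_int j0\<bar>)"
      using uj0 A K w_tri by (intro mult_left_mono) auto
    finally show ?thesis .
  qed
  ultimately show ?thesis by blast
qed

text \<open>The selection is applied to the squared moduli of \<open>c\<close> and of its image.
  Dividing by \<open>c j0\<close> and shifting \<open>j0\<close> to 0 leaves a vector whose growth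
  rate and local defect are both controlled by \<open>\<delta>\<close>.\<close>

lemma almost_kernel_normalised:
  assumes a: "a > 0" and d: "\<delta> > 0"
    and small: "\<And>A. A > 0 \<Longrightarrow> \<exists>x c. sqnorm c < \<infinity> \<and> sqnorm (gabor_fibre a h x c) < ennreal A * sqnorm c"
  shows "\<exists>y q. 0 \<le> y \<and> y \<le> a \<and> q 0 = 1 \<and> (\<forall>j. (norm (q j))\<^sup>2 \<le> 2 * exp (\<delta> * \<bar>of_int j\<bar>)) \<and>
    (\<forall>n. (norm (gabor_fibre a h y q n))\<^sup>2 \<le> \<delta> * exp (\<delta> * (\<bar>of_int n\<bar> * a + a)))"
proof -
  obtain K where K: "K > 0"
    "\<And>y::real. (\<integral>\<^sup>+i. ennreal (exp (- \<delta> * \<bar>y - of_int i\<bar>)) \<partial>count_space (UNIV :: int set)) \<le> ennreal K"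
    using exp_weight_bounded[OF d] by blast
  \<comment> \<open>With defect ratio \<open>A = \<delta> / K\<close> the factor
    \<open>A * K\<close> from the selection becomes \<open>\<delta>\<close>.\<close>
  have "\<delta> / K > 0" using d K by simp
  from small[OF this] obtain x c where xc: "sqnorm c < \<infinity>" "sqnorm (gabor_fibre a h x c) < ennreal (\<delta> / K) * sqnorm c"
    by blast
  obtain j0 where j0: "0 < (norm (c j0))\<^sup>2"
    "\<And>j. (norm (c j))\<^sup>2 \<le> 2 * (norm (c j0))\<^sup>2 * exp (\<delta> * \<bar>of_int j - of_int j0\<bar>)"
    "\<And>n. (norm (gabor_fibre a h x c n))\<^sup>2 \<le> \<delta> / K * K * (norm (c j0))\<^sup>2 * exp (\<delta> * \<bar>(of_int n * a - x) - of_int j0\<bar>)"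
    using weighted_selection[of "\<lambda>j. (norm (c j))\<^sup>2" "\<lambda>n. (norm (gabor_fibre a h x c n))\<^sup>2" \<delta> K "\<delta> / K" "\<lambda>n. of_int n * a - x"]
      xc d K by (auto simp: sqnorm_def)
  \<comment> \<open>Renumbering the rows by \<open>m\<close> brings the base point into
    \<open>[0, a]\<close>, a compact set independent of \<open>\<delta>\<close>.\<close>
  define m where "m = \<lfloor>(x + of_int j0) / a\<rfloor>"
  define y where "y = x + of_int j0 - of_int m * a"
  have "of_int m \<le> (x + of_int j0) / a" "(x + of_int j0) / a \<le> of_int m + 1" unfolding m_def by linarith+
  then have y: "0 \<le> y" "y \<le> a" using a by (auto simp: y_def field_simps)
  define q where "q j = inverse (c j0) * c (j + j0)" for j
  have cj0: "norm (c j0) > 0" using j0(1) by auto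
  have "q 0 = 1" using cj0 by (simp add: q_def)
  moreover have "(norm (q j))\<^sup>2 \<le> 2 * exp (\<delta> * \<bar>of_int j\<bar>)" for j
    using j0(2)[of "j + j0"] cj0 by (simp add: q_def norm_divide power_divide field_simps)
  moreover have "(norm (gabor_fibre a h y q n))\<^sup>2 \<le> \<delta> * exp (\<delta> * (\<bar>of_int n\<bar> * a + a))" for n
  proof -
    have "gabor_fibre a h y q n = inverse (c j0) * gabor_fibre a h x c (n + m)"
      unfolding q_def gabor_fibre_scale y_def gabor_fibre_shift ..
    then have "(norm (gabor_fibre a h y q n))\<^sup>2 = (norm (gabor_fibre a h x c (n + m)))\<^sup>2 / (norm (c j0))\<^sup>2"
      by (simp add: norm_mult norm_inverse power_mult_distrib power_inverse divide_inverse mult.commute)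
    also have "\<dots> \<le> \<delta> * exp (\<delta> * \<bar>(of_int (n + m) * a - x) - of_int j0\<bar>)"
      using j0(3)[of "n + m"] cj0 K(1) by (simp add: divide_le_eq mult_ac)
    also have "(of_int (n + m) * a - x) - of_int j0 = of_int n * a - y"
      by (simp add: y_def algebra_simps)
    also have "\<delta> * exp (\<delta> * \<bar>of_int n * a - y\<bar>) \<le> \<delta> * exp (\<delta> * (\<bar>of_int n\<bar> * a + a))"
    proof -
      have "\<bar>of_int n * a - y\<bar> \<le> \<bar>of_int n * a\<bar> + \<bar>y\<bar>" by (rule abs_triangle_ineq4)
      also have "\<dots> \<le> \<bar>of_int n\<bar> * a + a" using a y by (simp add: abs_mult)
      finally show ?thesis using d by (auto intro!: mult_left_mono)
    qed
    finally show ?thesis .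
  qed
  ultimately show ?thesis using y by blast
qed

text \<open>Tychonoff's theorem on the product of closed discs takes the place of a diagonal
  argument; continuity of the coordinates turns product convergence into pointwise
  convergence.\<close>

lemma compact_functions_int:
  fixes B :: "int \<Rightarrow> real" and q :: "nat \<Rightarrow> int \<Rightarrow> complex"
  assumes "\<And>k j. norm (q k j) \<le> B j"
  shows "\<exists>r l. strict_mono (r :: nat \<Rightarrow> nat) \<and> (\<forall>j. (\<lambda>k. q (r k) j) \<longlonglongrightarrow> l j)"
proof -
  have "compactin (product_topology (\<lambda>i. euclidean) UNIV) (PiE UNIV (\<lambda>j. cball (0::complex) (B j)))"
    unfolding compactin_PiE by (simp add: compact_cball)
  then have "compact (PiE UNIV (\<lambda>j. cball (0::complex) (B j)))"
    by (simp add: euclidean_product_topology)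
  then have "seq_compact (PiE UNIV (\<lambda>j. cball (0::complex) (B j)))"
    by (rule compact_imp_seq_compact)
  moreover have "\<forall>k. q k \<in> PiE UNIV (\<lambda>j. cball (0::complex) (B j))" using assms by auto
  ultimately obtain l r where "strict_mono r" "(q \<circ> r) \<longlonglongrightarrow> l"
    unfolding seq_compact_def by blast
  moreover have "(\<lambda>k. (q \<circ> r) k j) \<longlonglongrightarrow> l j" for j
  proof -
    have "isCont (\<lambda>f :: int \<Rightarrow> complex. f j) l"
      by (rule continuous_on_interior[OF continuous_on_product_coordinates]) simp
    then show ?thesis using \<open>(q \<circ> r) \<longlonglongrightarrow> l\<close> by (rule isCont_tendsto_compose)
  qed
  ultimately show ?thesis by (auto simp: o_def)
qed

text \<open>Some subsequence stays strictly left of \<open>y0\<close> or weakly right of it. The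
  side does not depend on the shift \<open>s\<close>, so a single \<open>k\<close> serves all matrix
  entries at once.\<close>

lemma one_sided_seq:
  fixes h l :: "real \<Rightarrow> complex" and y :: "nat \<Rightarrow> real"
  assumes rc: "\<And>t. (h \<longlongrightarrow> h t) (at_right t)" and ll: "\<And>t. (h \<longlongrightarrow> l t) (at_left t)"
    and y: "y \<longlonglongrightarrow> y0"
  shows "\<exists>r k. strict_mono (r :: nat \<Rightarrow> nat) \<and> k \<in> {h, l} \<and> (\<forall>s. (\<lambda>i. h (y (r i) + s)) \<longlonglongrightarrow> k (y0 + s))"
proof (cases "infinite {i. y i < y0}")
  case True
  then obtain r :: "nat \<Rightarrow> nat" where r: "strict_mono r" "\<And>i. y (r i) < y0"
    using infinite_enumerate[OF True] unfolding mem_Collect_eq by blast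
  have "(\<lambda>i. h (y (r i) + s)) \<longlonglongrightarrow> l (y0 + s)" for s
  proof (rule filterlim_compose[OF ll])
    have "(\<lambda>i. y (r i) + s) \<longlonglongrightarrow> y0 + s"
      using LIMSEQ_subseq_LIMSEQ[OF y r(1)] by (intro tendsto_intros) (simp add: o_def)
    then show "filterlim (\<lambda>i. y (r i) + s) (at_left (y0 + s)) sequentially"
      by (rule tendsto_imp_filterlim_at_left) (simp add: r)
  qed
  then show ?thesis using r(1) by blast
next
  case False
  have "{i. y i < y0} \<union> {i. y0 \<le> y i} = UNIV" by auto
  then have "infinite {i. y0 \<le> y i}" using False by (metis finite_Un infinite_UNIV_nat)
  then obtain r :: "nat \<Rightarrow> nat" where r: "strict_mono r" "\<And>i. y0 \<le> y (r i)"
    using infinite_enumerate[of "{i. y0 \<le> y i}"] unfolding mem_Collect_eq by blast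
  \<comment> \<open>Terms equal to \<open>y0\<close> may occur on this side, where \<open>h\<close>
    already has the limiting value; hence an epsilon argument rather than a limit through
    \<open>at_right\<close>.\<close>
  have "(\<lambda>i. h (y (r i) + s)) \<longlonglongrightarrow> h (y0 + s)" for s
  proof (rule tendstoI)
    fix e :: real assume e: "e > 0"
    have "eventually (\<lambda>x. dist (h x) (h (y0 + s)) < e) (at_right (y0 + s))"
      using rc e by (rule tendstoD)
    then obtain b where b: "b > y0 + s" "\<And>z. y0 + s < z \<Longrightarrow> z < b \<Longrightarrow> dist (h z) (h (y0 + s)) < e"
      unfolding eventually_at_right_field by blast
    have "(\<lambda>i. y (r i) + s) \<longlonglongrightarrow> y0 + s"
      using LIMSEQ_subseq_LIMSEQ[OF y r(1)] by (intro tendsto_intros) (simp add: o_def)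
    from order_tendstoD(2)[OF this b(1)]
    show "eventually (\<lambda>i. dist (h (y (r i) + s)) (h (y0 + s)) < e) sequentially"
    proof eventually_elim
      case (elim i)
      show ?case
      proof (cases "y (r i) = y0")
        case False
        then have "y0 + s < y (r i) + s" using r(2)[of i] by simp
        then show ?thesis using b(2) elim by blast
      qed (simp add: e)
    qed
  qed
  then show ?thesis using r(1) by blast
qed

text \<open>By contradiction: along a subsequence the normalised almost-kernel vectors with
  parameters \<open>d k\<close> tending to 0 converge pointwise to a bounded kernel vector
  \<open>Q\<close> for \<open>h\<close> or \<open>l\<close>. The normalisation survives as
  \<open>Q 0 = 1\<close>.\<close>

lemma sqnorm_gabor_fibre_ge:
  fixes h l :: "real \<Rightarrow> complex"
  assumes a: "a > 0"
    and rc: "\<And>t. (h \<longlongrightarrow> h t) (at_right t)" and ll: "\<And>t. (h \<longlongrightarrow> l t) (at_left t)"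
    and hS: "\<And>t. \<bar>t\<bar> > S \<Longrightarrow> h t = 0" and lS: "\<And>t. \<bar>t\<bar> > S \<Longrightarrow> l t = 0"
    and inj: "\<And>k t0 q. k \<in> {h, l} \<Longrightarrow> bounded (range q) \<Longrightarrow> (\<And>n. gabor_fibre a k t0 q n = 0) \<Longrightarrow> q = (\<lambda>_. 0)"
  shows "\<exists>A>0. \<forall>x c. sqnorm c < \<infinity> \<longrightarrow> ennreal A * sqnorm c \<le> sqnorm (gabor_fibre a h x c)"
proof (rule ccontr)
  assume "\<not> ?thesis"
  then have small: "\<And>A. A > 0 \<Longrightarrow> \<exists>x c. sqnorm c < \<infinity> \<and> sqnorm (gabor_fibre a h x c) < ennreal A * sqnorm c"
    by (meson not_le)
  define d where "d k = inverse (real (Suc k))" for k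
  have d: "0 < d k" "d k \<le> 1" for k by (simp_all add: d_def divide_simps)
  have dlim: "d \<longlonglongrightarrow> 0" unfolding d_def by (rule LIMSEQ_inverse_real_of_nat)
  have "\<forall>k. \<exists>y q. 0 \<le> y \<and> y \<le> a \<and> q 0 = 1 \<and> (\<forall>j. (norm (q j))\<^sup>2 \<le> 2 * exp (d k * \<bar>of_int j\<bar>)) \<and>
    (\<forall>n. (norm (gabor_fibre a h y q n))\<^sup>2 \<le> d k * exp (d k * (\<bar>of_int n\<bar> * a + a)))"
    by (intro allI almost_kernel_normalised[OF a d(1) small])
  then obtain y q where yq: "\<And>k. 0 \<le> y k" "\<And>k. y k \<le> a" "\<And>k. q k 0 = 1"
    "\<And>k j. (norm (q k j))\<^sup>2 \<le> 2 * exp (d k * \<bar>of_int j\<bar>)"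
    "\<And>k n. (norm (gabor_fibre a h (y k) (q k) n))\<^sup>2 \<le> d k * exp (d k * (\<bar>of_int n\<bar> * a + a))"
    by metis
  obtain y0 r1 where r1: "strict_mono r1" "(y \<circ> r1) \<longlonglongrightarrow> y0"
    using compact_Icc[of 0 a, unfolded compact_def, rule_format, of y] yq(1,2) by auto
  obtain r2 k where r2: "strict_mono r2" "k \<in> {h, l}"
    "\<And>s. (\<lambda>i. h ((y \<circ> r1) (r2 i) + s)) \<longlonglongrightarrow> k (y0 + s)"
    using one_sided_seq[OF rc ll r1(2)] by blast
  define r3 where "r3 = r1 \<circ> r2"
  have r3: "strict_mono r3" unfolding r3_def using r1 r2 by (intro strict_mono_o)
  \<comment> \<open>Compactness needs a bound independent of \<open>k\<close>;
    \<open>d k \<le> 1\<close> supplies one, though it still grows with \<open>j\<close>.\<close>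
  have "norm (q k j) \<le> sqrt (2 * exp \<bar>of_int j\<bar>)" for k j
  proof (rule real_le_rsqrt)
    have "d k * \<bar>of_int j\<bar> \<le> 1 * \<bar>of_int j\<bar>" using d by (intro mult_right_mono) auto
    then have "2 * exp (d k * \<bar>of_int j\<bar>) \<le> 2 * exp \<bar>of_int j\<bar>" by simp
    with yq(4)[of k j] show "(norm (q k j))\<^sup>2 \<le> 2 * exp \<bar>of_int j\<bar>" by (rule order_trans)
  qed
  then have q3: "norm ((q \<circ> r3) k j) \<le> sqrt (2 * exp \<bar>of_int j\<bar>)" for k j by simp
  from compact_functions_int[of "q \<circ> r3", OF q3] obtain r4 Q where
    r4: "strict_mono r4" "\<And>j. (\<lambda>i. (q \<circ> r3) (r4 i) j) \<longlonglongrightarrow> Q j"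
    by blast
  define r where "r = r3 \<circ> r4"
  have r: "strict_mono r" unfolding r_def using r3 r4 by (intro strict_mono_o)
  have Q: "(\<lambda>i. q (r i) j) \<longlonglongrightarrow> Q j" for j using r4(2) by (simp add: r_def o_def)
  have hk: "(\<lambda>i. h (y (r i) + s)) \<longlonglongrightarrow> k (y0 + s)" for s
    using LIMSEQ_subseq_LIMSEQ[OF r2(3)[of s] r4(1)] by (simp add: r_def r3_def o_def)
  have dr: "(\<lambda>i. d (r i)) \<longlonglongrightarrow> 0" using LIMSEQ_subseq_LIMSEQ[OF dlim r] by (simp add: o_def)
  have y0: "0 \<le> y0" "y0 \<le> a"
    using LIMSEQ_le_const[OF r1(2), of 0] LIMSEQ_le_const2[OF r1(2), of a] yq by auto
  have "gabor_fibre a k y0 Q n = 0" for n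
  proof -
    \<comment> \<open>One finite set of columns serves row \<open>n\<close> for every base point in
      \<open>[0, a]\<close>, hence for the sequence and its limit; \<open>max S 0\<close> keeps the
      radius nonnegative.\<close>
    define R where "R = max S 0 + a + \<bar>of_int n * a\<bar>"
    define J where "J = {j :: int. \<bar>0 - of_int j * 1\<bar> \<le> R}"
    have finJ: "finite J" unfolding J_def R_def using a by (intro card_int_progression) auto
    have out: "\<bar>z + of_int j - of_int n * a\<bar> > S" if "0 \<le> z" "z \<le> a" "j \<notin> J" for z j
      using that by (auto simp: J_def R_def)
    have "gabor_fibre a h (y (r i)) (q (r i)) n = (\<Sum>j\<in>J. q (r i) j * h (y (r i) + of_int j - of_int n * a))" for i
      by (rule gabor_fibre_eq_sum[OF finJ]) (use hS[OF out[OF yq(1,2)]] in simp)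
    moreover have "(\<lambda>i. \<Sum>j\<in>J. q (r i) j * h (y (r i) + of_int j - of_int n * a))
       \<longlonglongrightarrow> (\<Sum>j\<in>J. Q j * k (y0 + of_int j - of_int n * a))"
    proof (intro tendsto_sum tendsto_mult Q)
      fix j
      show "(\<lambda>i. h (y (r i) + of_int j - of_int n * a)) \<longlonglongrightarrow> k (y0 + of_int j - of_int n * a)"
        using hk[of "of_int j - of_int n * a"] by (simp add: add_diff_eq)
    qed
    moreover have "gabor_fibre a k y0 Q n = (\<Sum>j\<in>J. Q j * k (y0 + of_int j - of_int n * a))"
      by (rule gabor_fibre_eq_sum[OF finJ]) (use r2(2) hS[OF out[OF y0]] lS[OF out[OF y0]] in auto)
    ultimately have lim: "(\<lambda>i. gabor_fibre a h (y (r i)) (q (r i)) n) \<longlonglongrightarrow> gabor_fibre a k y0 Q n" by simp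
    have "(\<lambda>i. (norm (gabor_fibre a h (y (r i)) (q (r i)) n))\<^sup>2) \<longlonglongrightarrow> (norm (gabor_fibre a k y0 Q n))\<^sup>2"
      by (intro tendsto_intros lim)
    moreover have "(\<lambda>i. d (r i) * exp (d (r i) * (\<bar>of_int n\<bar> * a + a))) \<longlonglongrightarrow> 0 * exp (0 * (\<bar>of_int n\<bar> * a + a))"
      by (intro tendsto_intros dr)
    ultimately have "(norm (gabor_fibre a k y0 Q n))\<^sup>2 \<le> 0 * exp (0 * (\<bar>of_int n\<bar> * a + a))"
      by (rule LIMSEQ_le) (use yq(5) in blast)
    then show ?thesis by simp
  qed
  moreover have "bounded (range Q)"
  proof -
    \<comment> \<open>For fixed \<open>j\<close> the exponential factor tends to 1 as the rate tends
      to 0, so the bound left in the limit is the constant 2.\<close>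
    have "(norm (Q j))\<^sup>2 \<le> 2 * exp (0 * \<bar>of_int j\<bar>)" for j
    proof (rule LIMSEQ_le)
      show "(\<lambda>i. (norm (q (r i) j))\<^sup>2) \<longlonglongrightarrow> (norm (Q j))\<^sup>2" by (intro tendsto_intros Q)
      show "(\<lambda>i. 2 * exp (d (r i) * \<bar>of_int j\<bar>)) \<longlonglongrightarrow> 2 * exp (0 * \<bar>of_int j\<bar>)"
        by (intro tendsto_intros dr)
    qed (use yq(4) in blast)
    then have "norm (Q j) \<le> sqrt 2" for j by (intro real_le_rsqrt) simp
    then show ?thesis by (auto simp: bounded_iff)
  qed
  ultimately have "Q = (\<lambda>_. 0)" using inj[OF r2(2)] by blast
  moreover have "Q 0 = 1" using LIMSEQ_unique[OF Q[of 0]] yq(3) by auto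
  ultimately show False by simp
qed

subsection \<open>One-sided limits\<close>

lemma tendsto_right_lim: "has_one_sided_limits g \<Longrightarrow> (g \<longlongrightarrow> right_lim g t) (at_right t)"
  unfolding has_one_sided_limits_def right_lim_def by (metis tendsto_Lim trivial_limit_at_right_real)

lemma tendsto_left_lim: "has_one_sided_limits g \<Longrightarrow> (g \<longlongrightarrow> left_lim g t) (at_left t)"
  unfolding has_one_sided_limits_def left_lim_def by (metis tendsto_Lim trivial_limit_at_left_real)

text \<open>Non-strict bounds on an open set survive passage to one-sided limits at its points.
  Intervals give the continuity lemmas below; the whole line with \<open>L = 0\<close> gives norm
  bounds.\<close>

lemma dist_right_lim_le:
  assumes g: "has_one_sided_limits g" and U: "open U" "s \<in> U" and le: "\<And>u. u \<in> U \<Longrightarrow> dist (g u) L \<le> e"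
  shows "dist (right_lim g s) L \<le> e"
proof (rule tendsto_upperbound)
  show "((\<lambda>u. dist (g u) L) \<longlongrightarrow> dist (right_lim g s) L) (at_right s)"
    by (intro tendsto_intros tendsto_right_lim[OF g])
  have "eventually (\<lambda>u. u \<in> U) (at_right s)"
    using eventually_at_topological U by blast
  then show "eventually (\<lambda>u. dist (g u) L \<le> e) (at_right s)" by eventually_elim (rule le)
qed simp

lemma dist_left_lim_le:
  assumes g: "has_one_sided_limits g" and U: "open U" "s \<in> U" and le: "\<And>u. u \<in> U \<Longrightarrow> dist (g u) L \<le> e"
  shows "dist (left_lim g s) L \<le> e"
proof (rule tendsto_upperbound)
  show "((\<lambda>u. dist (g u) L) \<longlongrightarrow> dist (left_lim g s) L) (at_left s)"
    by (intro tendsto_intros tendsto_left_lim[OF g])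
  have "eventually (\<lambda>u. u \<in> U) (at_left s)"
    using eventually_at_topological U by blast
  then show "eventually (\<lambda>u. dist (g u) L \<le> e) (at_left s)" by eventually_elim (rule le)
qed simp

lemma right_lim_at_right:
  assumes g: "has_one_sided_limits g" shows "(right_lim g \<longlongrightarrow> right_lim g t) (at_right t)"
proof (rule tendstoI)
  fix e :: real assume e: "e > 0"
  have "eventually (\<lambda>x. dist (g x) (right_lim g t) < e / 2) (at_right t)"
    using tendsto_right_lim[OF g] e by (intro tendstoD) auto
  then obtain b where b: "b > t" "\<And>x. t < x \<Longrightarrow> x < b \<Longrightarrow> dist (g x) (right_lim g t) < e / 2"
    unfolding eventually_at_right_field by blast
  have "dist (right_lim g x) (right_lim g t) < e" if "t < x" "x < b" for x
    using dist_right_lim_le[OF g, of "{t<..<b}" x "right_lim g t" "e / 2"] b(2) e that by (force simp: less_imp_le)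
  then show "eventually (\<lambda>x. dist (right_lim g x) (right_lim g t) < e) (at_right t)"
    unfolding eventually_at_right_field using b(1) by blast
qed

text \<open>With \<open>right_lim_at_right\<close> this makes \<open>right_lim g\<close> a
  right-continuous function with left limits \<open>left_lim g\<close>, the form required of
  \<open>h\<close> and \<open>l\<close> in the fibre lemmas.\<close>

lemma right_lim_at_left:
  assumes g: "has_one_sided_limits g" shows "(right_lim g \<longlongrightarrow> left_lim g t) (at_left t)"
proof (rule tendstoI)
  fix e :: real assume e: "e > 0"
  have "eventually (\<lambda>x. dist (g x) (left_lim g t) < e / 2) (at_left t)"
    using tendsto_left_lim[OF g] e by (intro tendstoD) auto
  then obtain b where b: "b < t" "\<And>x. b < x \<Longrightarrow> x < t \<Longrightarrow> dist (g x) (left_lim g t) < e / 2"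
    unfolding eventually_at_left_field by blast
  have "dist (right_lim g x) (left_lim g t) < e" if "b < x" "x < t" for x
    using dist_right_lim_le[OF g, of "{b<..<t}" x "left_lim g t" "e / 2"] b(2) e that by (force simp: less_imp_le)
  then show "eventually (\<lambda>x. dist (right_lim g x) (left_lim g t) < e) (at_left t)"
    unfolding eventually_at_left_field using b(1) by blast
qed

lemma one_sided_limits_vanish:
  assumes g: "has_one_sided_limits g" and S: "\<And>t. \<bar>t\<bar> > S \<Longrightarrow> g t = 0" and t: "\<bar>t\<bar> > S"
  shows "right_lim g t = 0" "left_lim g t = 0"
proof -
  have "open {t::real. S < \<bar>t\<bar>}" by (intro open_Collect_less continuous_intros)
  then show "right_lim g t = 0" "left_lim g t = 0"
    using dist_right_lim_le[OF g, of "{t. S < \<bar>t\<bar>}" t 0 0] dist_left_lim_le[OF g, of "{t. S < \<bar>t\<bar>}" t 0 0] S t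
    by auto
qed

text \<open>Points with unbounded values would accumulate at some \<open>t\<close>, but near
  \<open>t\<close> the function is bounded in terms of its value and its two one-sided limits
  there.\<close>

lemma one_sided_limits_bounded:
  assumes g: "has_one_sided_limits g" and S: "\<And>t. \<bar>t\<bar> > S \<Longrightarrow> g t = 0"
  shows "\<exists>M. \<forall>t. norm (g t) \<le> M"
proof (rule ccontr)
  assume "\<not> ?thesis"
  then have "\<forall>k::nat. \<exists>x. norm (g x) > real k" by (meson not_le)
  then obtain x where x: "\<And>k::nat. norm (g (x k)) > real k" by metis
  have "x k \<in> {-S..S}" for k
  proof (rule ccontr)
    assume "x k \<notin> {-S..S}"
    then have "\<bar>x k\<bar> > S" by auto
    then show False using S[of "x k"] x[of k] by simp
  qed
  then obtain t r where r: "strict_mono (r :: nat \<Rightarrow> nat)" "(x \<circ> r) \<longlonglongrightarrow> t"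
    using compact_Icc[of "-S" S, unfolded compact_def, rule_format, of x] by auto
  define C where "C = max (norm (g t)) (max (norm (right_lim g t)) (norm (left_lim g t))) + 1"
  have "eventually (\<lambda>s. norm (g s) < C) (at_right t)"
    by (rule order_tendstoD(2)[OF tendsto_norm[OF tendsto_right_lim[OF g]]]) (simp add: C_def)
  moreover have "eventually (\<lambda>s. norm (g s) < C) (at_left t)"
    by (rule order_tendstoD(2)[OF tendsto_norm[OF tendsto_left_lim[OF g]]]) (simp add: C_def)
  ultimately have "eventually (\<lambda>s. norm (g s) < C) (at t)" by (simp add: eventually_at_split)
  moreover have "norm (g t) < C" by (simp add: C_def)
  ultimately have "eventually (\<lambda>s. norm (g s) < C) (nhds t)"
    by (auto simp: eventually_nhds_conv_at)
  then have ev: "eventually (\<lambda>k. norm (g ((x \<circ> r) k)) < C) sequentially"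
    using r(2) by (rule eventually_compose_filterlim)
  moreover have "eventually (\<lambda>k. C \<le> real k) sequentially"
    by (rule eventually_sequentiallyI[of "nat \<lceil>C\<rceil>"]) linarith
  ultimately have "eventually (\<lambda>k. False) sequentially"
  proof eventually_elim
    case (elim k)
    have "real k \<le> real (r k)" using seq_suble[OF r(1), of k] by simp
    then show ?case using elim x[of "r k"] by simp
  qed
  then show False by simp
qed

text \<open>The gap between \<open>g\<close> and \<open>right_lim g\<close> tends to 0 from both
  sides at every point, so the set where it exceeds \<open>inverse (real (Suc n))\<close> has no
  limit point and, lying in a compact interval, is finite.\<close>

lemma countable_neq_right_lim:
  assumes g: "has_one_sided_limits g" and S: "\<And>t. \<bar>t\<bar> > S \<Longrightarrow> g t = 0"
  shows "countable {t. g t \<noteq> right_lim g t}"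
proof -
  define E where "E n = {t. inverse (real (Suc n)) < dist (g t) (right_lim g t)}" for n
  have "finite (E n)" for n
  proof (rule ccontr)
    assume "infinite (E n)"
    moreover have "E n \<subseteq> {-S..S}"
    proof (rule subsetI, rule ccontr)
      fix t assume t: "t \<in> E n" "t \<notin> {-S..S}"
      then have "\<bar>t\<bar> > S" by auto
      then show False
        using S[of t] one_sided_limits_vanish(1)[of g S t] g S t(1) by (simp add: E_def)
    qed
    ultimately obtain t where t: "t islimpt E n"
      using Heine_Borel_imp_Bolzano_Weierstrass[OF compact_Icc] by blast
    have "((\<lambda>s. dist (g s) (right_lim g s)) \<longlongrightarrow> dist (right_lim g t) (right_lim g t)) (at_right t)"
      by (intro tendsto_dist tendsto_right_lim right_lim_at_right g)
    then have "eventually (\<lambda>s. dist (g s) (right_lim g s) < inverse (real (Suc n))) (at_right t)"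
      by (rule order_tendstoD) simp
    moreover have "((\<lambda>s. dist (g s) (right_lim g s)) \<longlongrightarrow> dist (left_lim g t) (left_lim g t)) (at_left t)"
      by (intro tendsto_dist tendsto_left_lim right_lim_at_left g)
    then have "eventually (\<lambda>s. dist (g s) (right_lim g s) < inverse (real (Suc n))) (at_left t)"
      by (rule order_tendstoD) simp
    ultimately have "eventually (\<lambda>s. dist (g s) (right_lim g s) < inverse (real (Suc n))) (at t)"
      by (simp add: eventually_at_split)
    then have "eventually (\<lambda>s. s \<notin> E n) (at t)" by eventually_elim (simp add: E_def)
    then show False using t by (simp add: islimpt_iff_eventually)
  qed
  then have "countable (\<Union>n. E n)" by (auto intro: countable_finite)
  moreover have "{t. g t \<noteq> right_lim g t} \<subseteq> (\<Union>n. E n)"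
  proof
    fix t assume "t \<in> {t. g t \<noteq> right_lim g t}"
    then have "0 < dist (g t) (right_lim g t)" by simp
    then obtain n where "inverse (real (Suc n)) < dist (g t) (right_lim g t)"
      using reals_Archimedean by blast
    then show "t \<in> (\<Union>n. E n)" by (auto simp: E_def)
  qed
  ultimately show ?thesis by (rule countable_subset[rotated])
qed

text \<open>\<open>right_lim g\<close> is the limit of \<open>g\<close> along grid points to the
  right of \<open>t\<close>. Each approximant depends on \<open>t\<close> only through an integer,
  which makes it measurable whatever \<open>g\<close> is.\<close>

lemma right_lim_measurable:
  assumes g: "has_one_sided_limits g" shows "right_lim g \<in> borel_measurable borel"
proof (rule borel_measurable_LIMSEQ_metric)
  \<comment> \<open>The summand 1 puts the grid point strictly right of \<open>t\<close>, also when
    \<open>t\<close> lies on the grid.\<close>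
  define p where "p n t = (of_int \<lfloor>real (Suc n) * t\<rfloor> + 1) / real (Suc n)" for n t
  fix n show "(\<lambda>t. g (p n t)) \<in> borel_measurable borel"
  proof -
    have "(\<lambda>t. \<lfloor>real (Suc n) * t\<rfloor>) \<in> measurable borel (count_space UNIV)" by measurable
    from measurable_compose[OF this, of "\<lambda>i. g ((of_int i + 1) / real (Suc n))" borel]
    show ?thesis by (simp add: p_def)
  qed
next
  define p where "p n t = (of_int \<lfloor>real (Suc n) * t\<rfloor> + 1) / real (Suc n)" for n t
  fix t :: real
  have p: "t < p n t" "p n t \<le> t + inverse (real (Suc n))" for n
  proof -
    have "real (Suc n) * t < of_int \<lfloor>real (Suc n) * t\<rfloor> + 1" by linarith
    then show "t < p n t" unfolding p_def by (subst less_divide_eq) (simp add: mult.commute)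
    have "of_int \<lfloor>real (Suc n) * t\<rfloor> + 1 \<le> real (Suc n) * t + 1" by linarith
    then have "p n t \<le> (real (Suc n) * t + 1) / real (Suc n)" unfolding p_def by (rule divide_right_mono) simp
    then show "p n t \<le> t + inverse (real (Suc n))" by (simp add: add_divide_distrib inverse_eq_divide)
  qed
  have "(\<lambda>n. p n t) \<longlonglongrightarrow> t"
  proof (rule tendsto_sandwich[of "\<lambda>_. t"])
    show "(\<lambda>n. t + inverse (real (Suc n))) \<longlonglongrightarrow> t"
      using tendsto_add[OF tendsto_const LIMSEQ_inverse_real_of_nat] by simp
  qed (use p in \<open>auto intro!: always_eventually less_imp_le\<close>)
  then have "filterlim (\<lambda>n. p n t) (at_right t) sequentially"
    by (rule tendsto_imp_filterlim_at_right) (simp add: p)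
  then show "(\<lambda>n. g (p n t)) \<longlonglongrightarrow> right_lim g t"
    by (rule filterlim_compose[OF tendsto_right_lim[OF g]])
qed

lemma one_sided_limits_measurable:
  assumes g: "has_one_sided_limits g" and S: "\<And>t. \<bar>t\<bar> > S \<Longrightarrow> g t = 0"
  shows "g \<in> borel_measurable borel"
  by (rule measurable_discrete_difference[OF right_lim_measurable[OF g] countable_neq_right_lim[OF g S]]) auto

section \<open>Square-integrability and periodization on the line\<close>

lemma sqint_bounded_support:
  fixes h :: "real \<Rightarrow> complex"
  assumes "h \<in> borel_measurable borel" "\<And>t. norm (h t) \<le> M" "\<And>t. \<bar>t\<bar> > S \<Longrightarrow> h t = 0"
  shows "sqint lborel h"
proof -
  have M: "M \<ge> 0" using norm_ge_zero assms(2) order_trans by blast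
  have "integrable lborel (\<lambda>x. (norm (h x))\<^sup>2)"
  proof (rule Bochner_Integration.integrable_bound)
    show "integrable lborel (\<lambda>x. indicator {-S..S} x * M\<^sup>2 :: real)"
      by (intro integrable_mult_left integrable_real_indicator) (auto simp: emeasure_lborel_Icc_eq)
    have "(norm (h x))\<^sup>2 \<le> indicator {-S..S} x * M\<^sup>2" for x
      using assms(2)[of x] assms(3)[of x] by (cases "x \<in> {-S..S}") (auto intro: power_mono)
    then show "AE x in lborel. norm ((norm (h x))\<^sup>2) \<le> norm (indicator {-S..S} x * M\<^sup>2)"
      by (simp add: abs_mult)
  qed (use assms(1) in simp)
  then show ?thesis using assms(1) by (simp add: sqint_def)
qed

lemma sqint_translate:
  assumes "sqint lborel (F :: real \<Rightarrow> complex)" shows "sqint lborel (\<lambda>x. F (x + t))"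
proof -
  have "F \<in> borel_measurable borel" "integrable lborel (\<lambda>x. (norm (F x))\<^sup>2)"
    using assms by (auto simp: sqint_def)
  then show ?thesis
    using lborel_integrable_real_affine[of "\<lambda>x. (norm (F x))\<^sup>2" 1 t] by (simp add: sqint_def add.commute)
qed

lemma L2R_iff_sqint: "f \<in> L2R \<longleftrightarrow> sqint lborel f"
  by (simp add: L2R_def sqint_def)

lemma integrable_circle: "integrable lborel F \<Longrightarrow> integrable circle_measure F"
  for F :: "real \<Rightarrow> 'a :: {banach, second_countable_topology}"
  unfolding circle_measure_def by (subst integrable_restrict_space) (auto intro: integrable_mult_indicator)

lemma sqint_circle: "sqint lborel F \<Longrightarrow> sqint circle_measure F"
  by (auto simp: sqint_def intro: integrable_circle borel_measurable_circle)

lemma indicator_floor: "indicator {0..<1} (x - of_int j) = (if j = \<lfloor>x\<rfloor> then 1 else 0)"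
  for x :: real
  by (auto simp: indicator_def) linarith+

text \<open>Writes 1 as the sum over \<open>j\<close> of the indicators of the unit intervals
  starting at \<open>j\<close>, then applies Tonelli and translates each interval back to
  \<open>[0, 1)\<close>.\<close>

lemma nn_integral_periodize:
  fixes f :: "real \<Rightarrow> ennreal"
  assumes [measurable]: "f \<in> borel_measurable borel"
  shows "(\<integral>\<^sup>+x. f x \<partial>lborel) = (\<integral>\<^sup>+x. (\<integral>\<^sup>+j. f (x + of_int j) \<partial>count_space UNIV) \<partial>circle_measure)"
proof -
  have "f x = (\<integral>\<^sup>+j. f x * indicator {0..<1} (x - of_int j) \<partial>count_space UNIV)" for x
    by (subst nn_integral_count_space'[of "{\<lfloor>x\<rfloor>}"]) (auto simp: indicator_floor)
  then have "(\<integral>\<^sup>+x. f x \<partial>lborel)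
      = (\<integral>\<^sup>+x. \<integral>\<^sup>+j. f x * indicator {0..<1} (x - of_int j) \<partial>count_space (UNIV :: int set) \<partial>lborel)"
    by (intro nn_integral_cong)
  also have "\<dots> = (\<integral>\<^sup>+j. \<integral>\<^sup>+x. f x * indicator {0..<1} (x - of_int j) \<partial>lborel \<partial>count_space (UNIV :: int set))"
    by (rule nn_integral_count_space_nn_integral) auto
  also have "\<dots> = (\<integral>\<^sup>+j. \<integral>\<^sup>+x. f (x + of_int j) * indicator {0..<1} x \<partial>lborel \<partial>count_space (UNIV :: int set))"
  proof (rule nn_integral_cong)
    fix j :: int
    show "(\<integral>\<^sup>+x. f x * indicator {0..<1} (x - of_int j) \<partial>lborel) = (\<integral>\<^sup>+x. f (x + of_int j) * indicator {0..<1} x \<partial>lborel)"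
      by (subst nn_integral_real_affine[where c = 1 and t = "of_int j"]) (auto simp: add.commute)
  qed
  also have "\<dots> = (\<integral>\<^sup>+j. \<integral>\<^sup>+x. f (x + of_int j) \<partial>circle_measure \<partial>count_space (UNIV :: int set))"
    unfolding circle_measure_def by (intro nn_integral_cong) (simp add: nn_integral_restrict_space)
  also have "\<dots> = (\<integral>\<^sup>+x. (\<integral>\<^sup>+j. f (x + of_int j) \<partial>count_space UNIV) \<partial>circle_measure)"
    by (rule nn_integral_count_space_nn_integral[symmetric]) (auto intro!: borel_measurable_circle)
  finally show ?thesis .
qed

text \<open>With finitely many contributing translates, linearity takes the place of Tonelli, which
  covers complex integrands.\<close>

lemma integral_periodize:
  fixes f :: "real \<Rightarrow> complex"
  assumes f: "integrable lborel f" and J: "finite J"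
    and 0: "\<And>x j. x \<in> {0..<1} \<Longrightarrow> j \<notin> J \<Longrightarrow> f (x + of_int j) = 0"
  shows "(\<integral>x. f x \<partial>lborel) = (\<integral>x. (\<Sum>j\<in>J. f (x + of_int j)) \<partial>circle_measure)"
proof -
  have [measurable]: "f \<in> borel_measurable borel" using f by auto
  have int: "integrable lborel (\<lambda>x. f (x + of_int j))" for j
    using lborel_integrable_real_affine[OF f, of 1 "of_int j"] by (simp add: add.commute)
  have int2: "integrable lborel (\<lambda>x. indicator {0..<1} (x - of_int j) *\<^sub>R f x)" for j
    using integrable_mult_indicator[OF _ f, of "{of_int j..<of_int j + 1}"]
    by (simp add: indicator_def algebra_simps)
  have "f x = (\<Sum>j\<in>J. indicator {0..<1} (x - of_int j) *\<^sub>R f x)" for x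
  proof (cases "\<lfloor>x\<rfloor> \<in> J")
    case True
    then show ?thesis using J by (simp add: indicator_floor sum.delta' if_distrib if_distribR cong: if_cong)
  next
    case False
    have "f (frac x + of_int \<lfloor>x\<rfloor>) = 0" by (rule 0) (use False frac_ge_0 frac_lt_1 in auto)
    then have "f x = 0" by (simp add: frac_def)
    then show ?thesis by simp
  qed
  then have "(\<integral>x. f x \<partial>lborel) = (\<integral>x. (\<Sum>j\<in>J. indicator {0..<1} (x - of_int j) *\<^sub>R f x) \<partial>lborel)"
    by (intro Bochner_Integration.integral_cong) auto
  also have "\<dots> = (\<Sum>j\<in>J. \<integral>x. indicator {0..<1} (x - of_int j) *\<^sub>R f x \<partial>lborel)"
    by (rule Bochner_Integration.integral_sum) (rule int2)
  also have "\<dots> = (\<Sum>j\<in>J. \<integral>x. f (x + of_int j) \<partial>circle_measure)"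
  proof (rule sum.cong[OF refl])
    fix j
    have "(\<integral>x. indicator {0..<1} (x - of_int j) *\<^sub>R f x \<partial>lborel) = (\<integral>x. indicator {0..<1} x *\<^sub>R f (x + of_int j) \<partial>lborel)"
      by (subst lborel_integral_real_affine[where c = 1 and t = "of_int j"]) (auto simp: add.commute)
    also have "\<dots> = (\<integral>x. f (x + of_int j) \<partial>circle_measure)"
      unfolding circle_measure_def by (simp add: integral_restrict_space)
    finally show "(\<integral>x. indicator {0..<1} (x - of_int j) *\<^sub>R f x \<partial>lborel) = (\<integral>x. f (x + of_int j) \<partial>circle_measure)" .
  qed
  also have "\<dots> = (\<integral>x. (\<Sum>j\<in>J. f (x + of_int j)) \<partial>circle_measure)"
    by (rule Bochner_Integration.integral_sum[symmetric]) (intro integrable_circle int)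
  finally show ?thesis .
qed

subsection \<open>Fiberization of the frame inequality\<close>

lemma borel_measurable_cnj [measurable (raw)]:
  "f \<in> borel_measurable M \<Longrightarrow> (\<lambda>x. cnj (f x)) \<in> borel_measurable M"
  by (rule borel_measurable_continuous_on[OF continuous_on_cnj[OF continuous_on_id]])

text \<open>Characters are 1-periodic, so periodizing \<open>f\<close> times the conjugate of the
  translated window turns inner products into Fourier coefficients of one function \<open>F\<close>.
  On the interval \<open>F\<close> is the conjugate of the fibre applied to the conjugated samples
  of \<open>f\<close>, whence the comparison of norms.\<close>

lemma gabor_coefficients:
  fixes h :: "real \<Rightarrow> complex"
  assumes f: "f \<in> L2R" and h: "h \<in> borel_measurable borel" and hM: "\<And>t. norm (h t) \<le> M"
    and hS: "\<And>t. \<bar>t\<bar> > S \<Longrightarrow> h t = 0" and S: "S \<ge> 0"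
  shows "\<exists>F. sqint circle_measure F \<and> (\<forall>m. L2_inner f (gabor_system h a (m, n)) = fourier_coeff F m) \<and>
    (\<forall>x\<in>{0..<1}. norm (F x) = norm (gabor_fibre a h x (\<lambda>j. cnj (f (x + of_int j))) n))"
proof -
  let ?h = "\<lambda>x. cnj (h (x - of_int n * a))"
  define \<phi> where "\<phi> x = f x * ?h x" for x
  have sf: "sqint lborel f" using f by (simp add: L2R_iff_sqint)
  have "sqint lborel h" by (rule sqint_bounded_support[OF h hM hS])
  from sqint_translate[OF this, of "- (of_int n * a)"]
  have sh: "sqint lborel ?h" using h unfolding sqint_def by simp
  have [measurable]: "f \<in> borel_measurable borel" "h \<in> borel_measurable borel"
    using sf h by (auto simp: sqint_def)
  have "\<phi> \<in> borel_measurable lborel" unfolding \<phi>_def by measurable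
  moreover have "norm (\<phi> x) \<le> M * norm (f x)" for x
    unfolding \<phi>_def norm_mult by (subst mult.commute) (intro mult_right_mono, auto simp: hM)
  ultimately have s\<phi>: "sqint lborel \<phi>" by (rule sqint_bound[OF _ sf])
  have i\<phi>: "integrable lborel \<phi>" unfolding \<phi>_def by (rule integrable_mult_sqint[OF sf sh])
  \<comment> \<open>The radius is \<open>S + 1\<close> because \<open>x\<close> varies over an
    interval of length 1.\<close>
  define J where "J = {j :: int. \<bar>of_int n * a - of_int j * 1\<bar> \<le> S + 1}"
  have J: "finite J" unfolding J_def using S by (intro card_int_progression) auto
  have out: "h (x + of_int j - of_int n * a) = 0" if "x \<in> {0..<1}" "j \<notin> J" for x j
    by (rule hS) (use that in \<open>auto simp: J_def\<close>)
  define F where "F x = (\<Sum>j\<in>J. \<phi> (x + of_int j))" for x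
  have sF: "sqint circle_measure F" unfolding F_def by (intro sqint_sum sqint_circle sqint_translate s\<phi>)
  moreover have "L2_inner f (gabor_system h a (m, n)) = fourier_coeff F m" for m
  proof -
    have e: "cnj (exp (- 2 * complex_of_real pi * \<i> * of_int m * complex_of_real x)) = fourier_char m x" for x
      by (simp add: fourier_char_def cis_conv_exp exp_cnj mult_ac)
    have "L2_inner f (gabor_system h a (m, n)) = (\<integral>x. \<phi> x * fourier_char m x \<partial>lborel)"
      unfolding L2_inner_def gabor_system_def prod.case complex_cnj_mult e
      by (simp add: \<phi>_def mult_ac)
    also have "\<dots> = (\<integral>x. (\<Sum>j\<in>J. \<phi> (x + of_int j) * fourier_char m (x + of_int j)) \<partial>circle_measure)"
    proof (rule integral_periodize[OF _ J])
      show "integrable lborel (\<lambda>x. \<phi> x * fourier_char m x)"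
        by (rule Bochner_Integration.integrable_bound[OF i\<phi>]) (auto simp: norm_mult \<phi>_def)
      show "\<phi> (x + of_int j) * fourier_char m (x + of_int j) = 0" if "x \<in> {0..<1}" "j \<notin> J" for x j
        using out[OF that] by (simp add: \<phi>_def)
    qed
    also have "\<dots> = fourier_coeff F m" by (simp add: fourier_coeff_def F_def fourier_char_int_shift sum_distrib_right)
    finally show ?thesis .
  qed
  moreover have "norm (F x) = norm (gabor_fibre a h x (\<lambda>j. cnj (f (x + of_int j))) n)" if x: "x \<in> {0..<1}" for x
  proof -
    have "gabor_fibre a h x (\<lambda>j. cnj (f (x + of_int j))) n = (\<Sum>j\<in>J. cnj (f (x + of_int j)) * h (x + of_int j - of_int n * a))"
      by (rule gabor_fibre_eq_sum[OF J]) (simp add: out[OF x])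
    also have "\<dots> = cnj (F x)" by (simp add: F_def \<phi>_def)
    finally show ?thesis by simp
  qed
  ultimately show ?thesis by blast
qed

text \<open>Parseval in the modulation index for each fixed translation \<open>n\<close>, then
  Tonelli to sum over \<open>n\<close> inside the integral.\<close>

lemma gabor_fiberization:
  fixes h :: "real \<Rightarrow> complex"
  assumes f: "f \<in> L2R" and h: "h \<in> borel_measurable borel" and hM: "\<And>t. norm (h t) \<le> M"
    and hS: "\<And>t. \<bar>t\<bar> > S \<Longrightarrow> h t = 0" and S: "S \<ge> 0"
  shows "(\<integral>\<^sup>+k. ennreal ((norm (L2_inner f (gabor_system h a k)))\<^sup>2) \<partial>count_space UNIV)
    = (\<integral>\<^sup>+x. sqnorm (gabor_fibre a h x (\<lambda>j. cnj (f (x + of_int j)))) \<partial>circle_measure)"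
proof -
  have "\<forall>n. \<exists>F. sqint circle_measure F \<and> (\<forall>m. L2_inner f (gabor_system h a (m, n)) = fourier_coeff F m) \<and>
    (\<forall>x\<in>{0..<1}. norm (F x) = norm (gabor_fibre a h x (\<lambda>j. cnj (f (x + of_int j))) n))"
    by (intro allI gabor_coefficients[OF f h hM hS S])
  then obtain F where F: "\<And>n. sqint circle_measure (F n)" "\<And>m n. L2_inner f (gabor_system h a (m, n)) = fourier_coeff (F n) m"
    "\<And>x n. x \<in> {0..<1} \<Longrightarrow> norm (F n x) = norm (gabor_fibre a h x (\<lambda>j. cnj (f (x + of_int j))) n)"
    by metis
  have [measurable]: "F n \<in> borel_measurable circle_measure" for n using F(1)[of n] by (simp add: sqint_def)
  have "(\<integral>\<^sup>+k. ennreal ((norm (L2_inner f (gabor_system h a k)))\<^sup>2) \<partial>count_space UNIV)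
    = (\<integral>\<^sup>+n. \<integral>\<^sup>+m. ennreal ((norm (L2_inner f (gabor_system h a (m, n))))\<^sup>2) \<partial>count_space UNIV \<partial>count_space UNIV)"
    by (rule nn_integral_snd_count_space[symmetric])
  also have "\<dots> = (\<integral>\<^sup>+n. \<integral>\<^sup>+x. ennreal ((norm (F n x))\<^sup>2) \<partial>circle_measure \<partial>count_space UNIV)"
  proof (intro nn_integral_cong)
    fix n
    have "(\<integral>\<^sup>+m. ennreal ((norm (fourier_coeff (F n) m))\<^sup>2) \<partial>count_space UNIV) = ennreal (\<integral>x. (norm (F n x))\<^sup>2 \<partial>circle_measure)"
      by (rule nn_integral_count_space_has_sum[OF parseval_circle[OF F(1)]]) simp
    also have "\<dots> = (\<integral>\<^sup>+x. ennreal ((norm (F n x))\<^sup>2) \<partial>circle_measure)"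
      by (rule nn_integral_eq_integral[symmetric]) (use F(1)[of n] in \<open>auto simp: sqint_def\<close>)
    finally show "(\<integral>\<^sup>+m. ennreal ((norm (L2_inner f (gabor_system h a (m, n))))\<^sup>2) \<partial>count_space UNIV)
        = (\<integral>\<^sup>+x. ennreal ((norm (F n x))\<^sup>2) \<partial>circle_measure)" by (simp add: F(2))
  qed
  also have "\<dots> = (\<integral>\<^sup>+x. \<integral>\<^sup>+n. ennreal ((norm (F n x))\<^sup>2) \<partial>count_space UNIV \<partial>circle_measure)"
    by (rule nn_integral_count_space_nn_integral[symmetric]) auto
  also have "\<dots> = (\<integral>\<^sup>+x. sqnorm (gabor_fibre a h x (\<lambda>j. cnj (f (x + of_int j)))) \<partial>circle_measure)"
    by (intro nn_integral_cong) (simp add: sqnorm_def F(3))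
  finally show ?thesis .
qed

lemma L2_norm_sq: "(L2_norm f)\<^sup>2 = (\<integral>x. (norm (f x))\<^sup>2 \<partial>lborel)"
  by (simp add: L2_norm_def)

lemma L2_norm_fiberization:
  assumes f: "f \<in> L2R"
  shows "ennreal ((L2_norm f)\<^sup>2) = (\<integral>\<^sup>+x. sqnorm (\<lambda>j. cnj (f (x + of_int j))) \<partial>circle_measure)"
proof -
  have [measurable]: "f \<in> borel_measurable borel" using f by (simp add: L2R_def)
  have "ennreal ((L2_norm f)\<^sup>2) = (\<integral>\<^sup>+x. ennreal ((norm (f x))\<^sup>2) \<partial>lborel)"
    unfolding L2_norm_sq using f by (intro nn_integral_eq_integral[symmetric]) (auto simp: L2R_def)
  also have "\<dots> = (\<integral>\<^sup>+x. \<integral>\<^sup>+j. ennreal ((norm (f (x + of_int j)))\<^sup>2) \<partial>count_space UNIV \<partial>circle_measure)"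
    by (rule nn_integral_periodize) measurable
  finally show ?thesis by (simp add: sqnorm_def)
qed

lemma sqnorm_fibre_measurable:
  assumes "f \<in> L2R" shows "(\<lambda>x. sqnorm (\<lambda>j. cnj (f (x + of_int j)))) \<in> borel_measurable circle_measure"
proof -
  have [measurable]: "f \<in> borel_measurable borel" using assms by (simp add: L2R_def)
  show ?thesis unfolding sqnorm_def
    by (intro borel_measurable_circle sigma_finite_measure.borel_measurable_nn_integral
        sigma_finite_measure_count_space_countable) auto
qed

text \<open>In \<open>ennreal\<close> the sum always exists, and the finite upper bound gives back
  the summability demanded by \<open>L2_frame\<close>.\<close>

lemma L2_frame_iff:
  assumes G: "\<And>k. G k \<in> L2R"
  shows "L2_frame G \<longleftrightarrow> (\<exists>A>0. \<exists>B>0. \<forall>f\<in>L2R.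
     ennreal A * ennreal ((L2_norm f)\<^sup>2) \<le> (\<integral>\<^sup>+k. ennreal ((norm (L2_inner f (G k)))\<^sup>2) \<partial>count_space UNIV) \<and>
     (\<integral>\<^sup>+k. ennreal ((norm (L2_inner f (G k)))\<^sup>2) \<partial>count_space UNIV) \<le> ennreal B * ennreal ((L2_norm f)\<^sup>2))"
proof -
  have key: "((\<lambda>k. (norm (L2_inner f (G k)))\<^sup>2) summable_on UNIV \<and>
        A * (L2_norm f)\<^sup>2 \<le> (\<Sum>\<^sub>\<infinity>k. (norm (L2_inner f (G k)))\<^sup>2) \<and>
        (\<Sum>\<^sub>\<infinity>k. (norm (L2_inner f (G k)))\<^sup>2) \<le> B * (L2_norm f)\<^sup>2) \<longleftrightarrow>
     (ennreal A * ennreal ((L2_norm f)\<^sup>2) \<le> (\<integral>\<^sup>+k. ennreal ((norm (L2_inner f (G k)))\<^sup>2) \<partial>count_space UNIV) \<and>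
     (\<integral>\<^sup>+k. ennreal ((norm (L2_inner f (G k)))\<^sup>2) \<partial>count_space UNIV) \<le> ennreal B * ennreal ((L2_norm f)\<^sup>2))"
    (is "?l \<longleftrightarrow> ?r") if AB: "A > 0" "B > 0" for A B f
  proof -
    let ?u = "\<lambda>k. (norm (L2_inner f (G k)))\<^sup>2"
    let ?N = "\<integral>\<^sup>+k. ennreal (?u k) \<partial>count_space UNIV"
    show ?thesis
    proof
      assume l: ?l
      then have "(?u has_sum infsum ?u UNIV) UNIV" by (simp add: has_sum_infsum)
      from nn_integral_count_space_has_sum[OF this] have "?N = ennreal (infsum ?u UNIV)" by simp
      then show ?r using l AB by (simp add: ennreal_mult[symmetric] ennreal_leI)
    next
      assume r: ?r
      then have "?N < \<infinity>" by (auto simp: ennreal_mult_less_top intro: le_less_trans)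
      then obtain s where s: "?N = ennreal s" "s \<ge> 0" by (cases ?N) auto
      then have hs: "(?u has_sum s) UNIV" by (intro has_sum_nn_integral_count_space) auto
      then have "infsum ?u UNIV = s" "?u summable_on UNIV" by (auto simp: infsumI summable_on_def)
      then show ?l using r AB s by (simp add: ennreal_mult[symmetric])
    qed
  qed
  show ?thesis
    unfolding L2_frame_def
    by (simp only: G simp_thms)
       (rule ex_cong1, rule conj_cong[OF refl], rule ex_cong1, rule conj_cong[OF refl], rule ball_cong[OF refl], rule key)
qed

lemma gabor_in_L2R:
  assumes "g \<in> borel_measurable borel" "\<And>t. norm (g t) \<le> M" "\<And>t. \<bar>t\<bar> > S \<Longrightarrow> g t = 0"
  shows "gabor_system g a k \<in> L2R"
proof (cases k)
  case (Pair m n)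
  have [measurable]: "g \<in> borel_measurable borel" by fact
  have "sqint lborel (\<lambda>x. g (x + (- (of_int n * a))))"
    by (rule sqint_translate[OF sqint_bounded_support[OF assms]])
  then have "sqint lborel (gabor_system g a (m, n))"
    by (rule sqint_bound[where C = 1, rotated]) (auto simp: gabor_system_def norm_mult)
  then show ?thesis by (simp add: Pair L2R_iff_sqint)
qed

text \<open>Countable sets are null. This lets a window be exchanged for its right-continuous
  version in all inner products.\<close>

lemma L2_inner_gabor_cong:
  assumes "f \<in> L2R" "g \<in> borel_measurable borel" "h \<in> borel_measurable borel"
    and ct: "countable {t. g t \<noteq> h t}"
  shows "L2_inner f (gabor_system g a k) = L2_inner f (gabor_system h a k)"
proof (cases k)
  case (Pair m n)
  have [measurable]: "f \<in> borel_measurable borel" "g \<in> borel_measurable borel" "h \<in> borel_measurable borel"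
    using assms by (auto simp: L2R_def)
  have "countable ((\<lambda>t. t + of_int n * a) ` {t. g t \<noteq> h t})" using ct by (rule countable_image)
  moreover have "{x. g (x - of_int n * a) \<noteq> h (x - of_int n * a)} \<subseteq> (\<lambda>t. t + of_int n * a) ` {t. g t \<noteq> h t}"
    by (auto intro!: image_eqI[of _ _ "_ - of_int n * a"])
  ultimately have "countable {x. g (x - of_int n * a) \<noteq> h (x - of_int n * a)}" by (rule countable_subset[rotated])
  then have "{x. g (x - of_int n * a) \<noteq> h (x - of_int n * a)} \<in> null_sets lborel"
    by (rule countable_imp_null_set_lborel)
  then have "AE x in lborel. g (x - of_int n * a) = h (x - of_int n * a)"
    by (rule AE_I') auto
  then show ?thesis unfolding Pair L2_inner_def gabor_system_def prod.case
    by (intro integral_cong_AE) (auto elim: eventually_mono)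
qed

subsection \<open>From a bounded kernel to the failure of the lower bound\<close>

text \<open>Cut \<open>q\<close> off by a triangle of half-width \<open>R\<close>. The kernel
  relation allows subtracting the cut-off's value at the row position, and within the reach of a row
  the cut-off varies by at most \<open>S / R\<close>. Rows have size O(1/R) and O(R) of them are
  nonzero, so the squared defect is O(1/R) while the norm of the vector stays bounded below.\<close>

lemma truncated_kernel:
  fixes k :: "real \<Rightarrow> complex" and q :: "int \<Rightarrow> complex"
  assumes a: "a > 0" and S: "S \<ge> 0" and kS: "\<And>t. \<bar>t\<bar> > S \<Longrightarrow> k t = 0" and kM: "\<And>t. norm (k t) \<le> M"
    and q: "bounded (range q)" "q j1 \<noteq> 0" and ker: "\<And>n. gabor_fibre a k t0 q n = 0" and e: "\<epsilon> > 0"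
  shows "\<exists>c. finite {j. c j \<noteq> 0} \<and> sqnorm (gabor_fibre a k t0 c) < ennreal \<epsilon> * sqnorm c"
proof -
  have M: "M \<ge> 0" using norm_ge_zero kM order_trans by blast
  obtain Q where Q: "\<And>j. norm (q j) \<le> Q" using q(1) by (auto simp: bounded_iff)
  have Q0: "Q \<ge> 0" using norm_ge_zero Q order_trans by blast
  \<comment> \<open>\<open>C / R\<close> will bound each row: the number of columns met, times the
    bounds on \<open>q\<close>, on the variation of the cut-off and on \<open>k\<close>.
    \<open>D / R\<close> bounds the sum of the squares, and \<open>\<eta>\<close> is
    \<open>\<epsilon>\<close> times a lower bound for \<open>sqnorm c\<close>.\<close>
  define C where "C = (2 * S + 1) * (Q * S * M)"
  have C: "C \<ge> 0" unfolding C_def using S Q0 M by simp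
  define D where "D = (2 * (1 + S) / a + 1) * C\<^sup>2"
  define \<eta> where "\<eta> = \<epsilon> * ((norm (q j1))\<^sup>2 / 4)"
  have \<eta>: "\<eta> > 0" unfolding \<eta>_def using e q(2) by simp
  \<comment> \<open>The bound by \<open>j1\<close> keeps at least half of \<open>q j1\<close>, the
    bound by \<open>D / \<eta>\<close> makes the defect small, and \<open>R \<ge> 1\<close> absorbs
    lower-order constants.\<close>
  define R where "R = max (max 1 (2 * \<bar>of_int j1\<bar>)) (D / \<eta> + 1)"
  have R: "R \<ge> 1" "R \<ge> 2 * \<bar>of_int j1\<bar>" "R > D / \<eta>" unfolding R_def by auto
  define \<phi> where "\<phi> x = max 0 (1 - \<bar>x\<bar> / R)" for x :: real
  have lip: "\<bar>\<phi> x - \<phi> y\<bar> \<le> \<bar>x - y\<bar> / R" for x y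
  proof -
    have "\<bar>\<phi> x - \<phi> y\<bar> \<le> \<bar>\<bar>y\<bar> / R - \<bar>x\<bar> / R\<bar>" unfolding \<phi>_def by linarith
    also have "\<dots> = \<bar>\<bar>y\<bar> - \<bar>x\<bar>\<bar> / R" using R(1) by (simp add: diff_divide_distrib[symmetric])
    also have "\<dots> \<le> \<bar>x - y\<bar> / R" using R(1) by (intro divide_right_mono) linarith+
    finally show ?thesis .
  qed
  have \<phi>0: "\<phi> x = 0" if "\<bar>x\<bar> > R" for x using that R(1) by (simp add: \<phi>_def field_simps)
  define c where "c j = \<phi> (of_int j) *\<^sub>R q j" for j
  have "{j. c j \<noteq> 0} \<subseteq> {j :: int. \<bar>0 - of_int j * 1\<bar> \<le> R}"
    using \<phi>0 by (force simp: c_def)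
  then have fin: "finite {j. c j \<noteq> 0}"
    by (rule finite_subset) (use R in \<open>intro card_int_progression; simp\<close>)
  have PPc: "norm (gabor_fibre a k t0 c n) \<le> C / R" for n
  proof -
    define J where "J = {j :: int. \<bar>(of_int n * a - t0) - of_int j * 1\<bar> \<le> S}"
    have finJ: "finite J" and cardJ: "real (card J) \<le> 2 * S + 1"
      unfolding J_def using card_int_progression[of 1 S "of_int n * a - t0"] S by auto
    have out: "k (t0 + of_int j - of_int n * a) = 0" if "j \<notin> J" for j
      using that by (intro kS) (auto simp: J_def)
    let ?y = "of_int n * a - t0"
    \<comment> \<open>The subtracted sum is zero by \<open>ker\<close>; it replaces the cut-off by
      its variation about the row position \<open>?y\<close>.\<close>
    have "gabor_fibre a k t0 c n = (\<Sum>j\<in>J. c j * k (t0 + of_int j - of_int n * a)) - \<phi> ?y *\<^sub>R (\<Sum>j\<in>J. q j * k (t0 + of_int j - of_int n * a))"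
      using gabor_fibre_eq_sum[OF finJ, of c k t0 n a] gabor_fibre_eq_sum[OF finJ, of q k t0 n a] out ker[of n] by simp
    also have "\<dots> = (\<Sum>j\<in>J. (\<phi> (of_int j) - \<phi> ?y) *\<^sub>R (q j * k (t0 + of_int j - of_int n * a)))"
      by (simp add: c_def scaleR_sum_right sum_subtractf[symmetric] scaleR_diff_left)
    also have "norm \<dots> \<le> (\<Sum>j\<in>J. S / R * (Q * M))"
    proof (rule sum_norm_le)
      fix j assume "j \<in> J"
      then have "\<bar>of_int j - ?y\<bar> / R \<le> S / R" using R(1) by (intro divide_right_mono) (auto simp: J_def)
      then have "\<bar>\<phi> (of_int j) - \<phi> ?y\<bar> \<le> S / R" using lip order_trans by blast
      then show "norm ((\<phi> (of_int j) - \<phi> ?y) *\<^sub>R (q j * k (t0 + of_int j - of_int n * a))) \<le> S / R * (Q * M)"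
        unfolding norm_scaleR norm_mult using Q kM S R(1) Q0 M by (intro mult_mono) auto
    qed
    also have "\<dots> = real (card J) * (S / R * (Q * M))" by simp
    also have "\<dots> \<le> (2 * S + 1) * (S / R * (Q * M))"
      using cardJ S R(1) Q0 M by (intro mult_right_mono) auto
    also have "\<dots> = C / R" by (simp add: C_def mult_ac)
    finally show ?thesis .
  qed
  define N where "N = {n :: int. \<bar>t0 - of_int n * a\<bar> \<le> R + S}"
  have finN: "finite N" and cardN: "real (card N) \<le> 2 * (R + S) / a + 1"
    unfolding N_def using card_int_progression[OF a, of "R + S" t0] S R(1) by auto
  have PPN: "gabor_fibre a k t0 c n = 0" if "n \<notin> N" for n
  proof -
    have "c j * k (t0 + of_int j - of_int n * a) = 0" for j
    proof (cases "\<bar>of_int j\<bar> > R")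
      case True then show ?thesis by (simp add: c_def \<phi>0)
    next
      case False
      then have "\<bar>t0 + of_int j - of_int n * a\<bar> > S" using that unfolding N_def mem_Collect_eq by linarith
      then show ?thesis by (simp add: kS)
    qed
    then show ?thesis unfolding gabor_fibre_def by (simp only: infsum_0)
  qed
  have "sqnorm (gabor_fibre a k t0 c) = (\<Sum>n\<in>N. ennreal ((norm (gabor_fibre a k t0 c n))\<^sup>2))"
    unfolding sqnorm_def by (rule nn_integral_count_space'[OF finN]) (auto simp: PPN)
  also have "\<dots> \<le> (\<Sum>n\<in>N. ennreal ((C / R)\<^sup>2))"
    by (intro sum_mono ennreal_leI power_mono PPc) simp
  also have "\<dots> = ennreal (real (card N) * (C / R)\<^sup>2)"
    by (simp add: ennreal_mult' ennreal_of_nat_eq_real_of_nat)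
  also have "real (card N) * (C / R)\<^sup>2 \<le> D / R"
  proof -
    have "S \<le> S * R" using S R(1) by (simp add: mult_le_cancel_left1)
    then have "2 * (R + S) / a + 1 \<le> 2 * ((1 + S) * R) / a + 1 * R"
      using a R(1) by (intro add_mono divide_right_mono) (auto simp: algebra_simps)
    also have "\<dots> = (2 * (1 + S) / a + 1) * R" by (simp add: field_simps)
    finally have "real (card N) \<le> (2 * (1 + S) / a + 1) * R" using cardN by linarith
    then have "real (card N) * (C / R)\<^sup>2 \<le> ((2 * (1 + S) / a + 1) * R) * (C / R)\<^sup>2"
      by (rule mult_right_mono) simp
    also have "\<dots> = D / R" using R(1) by (simp add: D_def power2_eq_square field_simps)
    finally show ?thesis .
  qed
  finally have "sqnorm (gabor_fibre a k t0 c) \<le> ennreal (D / R)" by (simp add: ennreal_leI)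
  also have "D / R < \<eta>" using R(1,3) \<eta> by (simp add: field_simps)
  then have "ennreal (D / R) < ennreal \<eta>" using \<eta> by (simp add: ennreal_lessI)
  finally have 1: "sqnorm (gabor_fibre a k t0 c) < ennreal \<eta>" .
  have "1 / 2 \<le> \<phi> (of_int j1)"
    using R(1,2) by (auto simp: \<phi>_def field_simps)
  then have "1 / 2 * norm (q j1) \<le> \<bar>\<phi> (of_int j1)\<bar> * norm (q j1)" by (intro mult_right_mono) auto
  then have "1 / 2 * norm (q j1) \<le> norm (c j1)" by (simp add: c_def)
  from power_mono[OF this, of 2] have "(norm (q j1))\<^sup>2 / 4 \<le> (norm (c j1))\<^sup>2"
    by (simp add: power_mult_distrib power_divide)
  then have "ennreal ((norm (q j1))\<^sup>2 / 4) \<le> ennreal ((norm (c j1))\<^sup>2)" by (rule ennreal_leI)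
  also have "\<dots> \<le> sqnorm c" unfolding sqnorm_def by (rule nn_integral_ge_point) simp
  finally have "ennreal \<epsilon> * ennreal ((norm (q j1))\<^sup>2 / 4) \<le> ennreal \<epsilon> * sqnorm c"
    by (rule mult_left_mono) simp
  moreover have "ennreal \<eta> = ennreal \<epsilon> * ennreal ((norm (q j1))\<^sup>2 / 4)"
    unfolding \<eta>_def using e by (intro ennreal_mult') auto
  ultimately have "sqnorm (gabor_fibre a k t0 c) < ennreal \<epsilon> * sqnorm c" using 1 by (simp add: less_le_trans)
  then show ?thesis using fin by blast
qed

text \<open>Finite support of \<open>c\<close> confines the image to finitely many rows, the same
  for all base points within 1 of \<open>t0\<close>, so the norm is a finite sum converging along
  \<open>Fl\<close>. The filter will be \<open>at_right t0\<close> with \<open>k = h\<close> or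
  \<open>at_left t0\<close> with \<open>k = l\<close>.\<close>

lemma eventually_sqnorm_gabor_fibre_less:
  assumes a: "a > 0" and S: "S \<ge> 0" and hS: "\<And>t. \<bar>t\<bar> > S \<Longrightarrow> h t = 0" and kS: "\<And>t. \<bar>t\<bar> > S \<Longrightarrow> k t = 0"
    and c: "finite {j. c j \<noteq> 0}" and less: "sqnorm (gabor_fibre a k t0 c) < b"
    and Fl: "Fl \<le> nhds t0" and lim: "\<And>s. ((\<lambda>t. h (t + s)) \<longlongrightarrow> k (t0 + s)) Fl"
  shows "eventually (\<lambda>t. sqnorm (gabor_fibre a h t c) < b) Fl"
proof -
  let ?J = "{j. c j \<noteq> 0}"
  define R where "R = (\<Sum>j\<in>?J. \<bar>of_int j :: real\<bar>)"
  have R: "\<bar>of_int j\<bar> \<le> R" if "c j \<noteq> 0" for j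
    unfolding R_def using c that by (intro member_le_sum) auto
  have R0: "R \<ge> 0" unfolding R_def by (intro sum_nonneg) auto
  define N where "N = {n :: int. \<bar>t0 - of_int n * a\<bar> \<le> R + S + 1}"
  have finN: "finite N" unfolding N_def using R0 S by (intro card_int_progression a) auto
  have sq: "sqnorm (gabor_fibre a k' t c) = ennreal (\<Sum>n\<in>N. (norm (gabor_fibre a k' t c n))\<^sup>2)"
    if t: "dist t t0 < 1" and k': "\<And>t. \<bar>t\<bar> > S \<Longrightarrow> k' t = 0" for t k'
  proof -
    have "gabor_fibre a k' t c n = 0" if n: "n \<notin> N" for n
    proof -
      have "c j * k' (t + of_int j - of_int n * a) = 0" for j
      proof (cases "c j = 0")
        case False
        then have "\<bar>t + of_int j - of_int n * a\<bar> > S"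
          using R[OF False] n t unfolding N_def mem_Collect_eq dist_real_def by linarith
        then show ?thesis by (simp add: k')
      qed simp
      then show ?thesis unfolding gabor_fibre_def by (simp only: infsum_0)
    qed
    then have "sqnorm (gabor_fibre a k' t c) = (\<Sum>n\<in>N. ennreal ((norm (gabor_fibre a k' t c n))\<^sup>2))"
      unfolding sqnorm_def by (intro nn_integral_count_space'[OF finN]) auto
    then show ?thesis by simp
  qed
  have PPJ: "gabor_fibre a k' t c n = (\<Sum>j\<in>?J. c j * k' (t + of_int j - of_int n * a))" for k' t n
    by (rule gabor_fibre_eq_sum[OF c]) auto
  have "((\<lambda>t. gabor_fibre a h t c n) \<longlongrightarrow> gabor_fibre a k t0 c n) Fl" for n
    unfolding PPJ
  proof (intro tendsto_sum tendsto_mult tendsto_const)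
    fix j show "((\<lambda>t. h (t + of_int j - of_int n * a)) \<longlongrightarrow> k (t0 + of_int j - of_int n * a)) Fl"
      using lim[of "of_int j - of_int n * a"] by (simp add: add_diff_eq)
  qed
  then have "((\<lambda>t. ennreal (\<Sum>n\<in>N. (norm (gabor_fibre a h t c n))\<^sup>2)) \<longlongrightarrow> ennreal (\<Sum>n\<in>N. (norm (gabor_fibre a k t0 c n))\<^sup>2)) Fl"
    by (intro tendsto_ennrealI tendsto_sum tendsto_power tendsto_norm)
  then have "eventually (\<lambda>t. ennreal (\<Sum>n\<in>N. (norm (gabor_fibre a h t c n))\<^sup>2) < b) Fl"
    by (rule order_tendstoD(2)) (use less sq[of t0 k] kS in simp)
  moreover have "eventually (\<lambda>t. dist t t0 < 1) Fl"
    by (rule filter_leD[OF Fl], unfold eventually_nhds_metric) (rule exI[of _ 1], simp)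
  ultimately show ?thesis
    by eventually_elim (simp add: sq hS)
qed

lemma interval_translate_unique:
  fixes x :: real and p i :: int
  assumes "x + of_int p \<in> {\<alpha><..<\<beta>}" "x + of_int i \<in> {\<alpha><..<\<beta>}" "\<beta> \<le> \<alpha> + 1"
  shows "i = p"
proof -
  have "real_of_int i < of_int p + 1" "real_of_int p < of_int i + 1" using assms by auto
  then show ?thesis by linarith
qed

text \<open>The integer translates of an interval of length at most 1 are disjoint, so fibres over
  it can be prescribed: \<open>f\<close> takes the conjugates of the \<open>c j\<close> on the
  translates. Its conjugated fibre at any \<open>x\<close> is zero or a shift of \<open>c\<close>,
  and the fibrewise bound integrates.\<close>

lemma fibre_small_imp_not_lower_bound:
  fixes h :: "real \<Rightarrow> complex" and c :: "int \<Rightarrow> complex"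
  assumes h: "h \<in> borel_measurable borel" and hM: "\<And>t. norm (h t) \<le> M"
    and hS: "\<And>t. \<bar>t\<bar> > S \<Longrightarrow> h t = 0" and S: "S \<ge> 0"
    and c: "finite {j. c j \<noteq> 0}" and cj: "c j1 \<noteq> 0" and I: "\<alpha> < \<beta>" "\<beta> \<le> \<alpha> + 1" and e: "\<epsilon> \<ge> 0"
    and small: "\<And>t. t \<in> {\<alpha><..<\<beta>} \<Longrightarrow> sqnorm (gabor_fibre a h t c) \<le> ennreal \<epsilon> * sqnorm c"
  shows "\<exists>f\<in>L2R. 0 < L2_norm f \<and>
    (\<integral>\<^sup>+k. ennreal ((norm (L2_inner f (gabor_system h a k)))\<^sup>2) \<partial>count_space UNIV)
      \<le> ennreal \<epsilon> * ennreal ((L2_norm f)\<^sup>2)"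
proof -
  let ?J = "{j. c j \<noteq> 0}"
  define f where "f x = (\<Sum>i\<in>?J. cnj (c i) * indicator {\<alpha><..<\<beta>} (x + of_int (- i)))" for x
  have "sqint lborel (indicator {\<alpha><..<\<beta>} :: real \<Rightarrow> complex)"
    by (rule sqint_bounded_support[of _ 1 "max \<bar>\<alpha>\<bar> \<bar>\<beta>\<bar>"]) (auto simp: indicator_def)
  then have sf: "sqint lborel f"
    unfolding f_def by (intro sqint_sum sqint_cmult sqint_translate)
  then have f: "f \<in> L2R" by (simp add: L2R_iff_sqint)
  have f1: "cnj (f (x + of_int j)) = c (j - p)" if p: "x + of_int p \<in> {\<alpha><..<\<beta>}" for x j p
  proof -
    have *: "x + of_int j + of_int (- i) \<in> {\<alpha><..<\<beta>} \<longleftrightarrow> i = j - p" for i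
      using interval_translate_unique[OF p _ I(2), of "j - i"] p by (auto simp: algebra_simps)
    have "f (x + of_int j) = (\<Sum>i\<in>?J. if i = j - p then cnj (c i) else 0)"
      unfolding f_def by (rule sum.cong[OF refl]) (simp only: indicator_def * split: if_split, simp)
    also have "\<dots> = cnj (c (j - p))" using c by (simp add: sum.delta')
    finally show ?thesis by simp
  qed
  have f0: "f (x + of_int j) = 0" if "\<And>p. x + of_int p \<notin> {\<alpha><..<\<beta>}" for x j
  proof -
    have "x + of_int j + of_int (- i) \<notin> {\<alpha><..<\<beta>}" for i
      using that[of "j + (- i)"] by (simp only: of_int_add add.assoc not_False_eq_True)
    then show ?thesis unfolding f_def by (intro sum.neutral ballI) (simp only: indicator_def if_False of_bool_eq mult_zero_right)
  qed
  have le: "sqnorm (gabor_fibre a h x (\<lambda>j. cnj (f (x + of_int j)))) \<le> ennreal \<epsilon> * sqnorm (\<lambda>j. cnj (f (x + of_int j)))" for x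
  proof (cases "\<exists>p. x + of_int p \<in> {\<alpha><..<\<beta>}")
    case True
    then obtain p where p: "x + of_int p \<in> {\<alpha><..<\<beta>}" ..
    have "gabor_fibre a h x (\<lambda>j. c (j - p)) n = gabor_fibre a h (x + of_int p) c n" for n
      using gabor_fibre_shift[of a h x p 0 "\<lambda>j. c (j - p)" n] by simp
    then have "gabor_fibre a h x (\<lambda>j. c (j - p)) = gabor_fibre a h (x + of_int p) c" by blast
    moreover have "sqnorm (\<lambda>j. c (j - p)) = sqnorm c"
      by (rule sqnorm_reindex) (rule bij_betw_byWitness[where f' = "\<lambda>j. j + p"], auto)
    ultimately show ?thesis using small[OF p] by (simp add: f1[OF p])
  next
    case False
    then have "(\<lambda>j. cnj (f (x + of_int j))) = (\<lambda>_. 0)" using f0 by auto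
    then show ?thesis by (simp add: sqnorm_def gabor_fibre_def)
  qed
  have fib: "(\<integral>\<^sup>+k. ennreal ((norm (L2_inner f (gabor_system h a k)))\<^sup>2) \<partial>count_space UNIV)
      = (\<integral>\<^sup>+x. sqnorm (gabor_fibre a h x (\<lambda>j. cnj (f (x + of_int j)))) \<partial>circle_measure)"
      by (rule gabor_fiberization[OF f h hM hS S])
  have "(\<integral>\<^sup>+k. ennreal ((norm (L2_inner f (gabor_system h a k)))\<^sup>2) \<partial>count_space UNIV)
     \<le> (\<integral>\<^sup>+x. ennreal \<epsilon> * sqnorm (\<lambda>j. cnj (f (x + of_int j))) \<partial>circle_measure)"
    unfolding fib by (intro nn_integral_mono le)
  also have "\<dots> = ennreal \<epsilon> * ennreal ((L2_norm f)\<^sup>2)"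
    unfolding L2_norm_fiberization[OF f] by (rule nn_integral_cmult) (rule sqnorm_fibre_measurable[OF f])
  finally have main: "(\<integral>\<^sup>+k. ennreal ((norm (L2_inner f (gabor_system h a k)))\<^sup>2) \<partial>count_space UNIV)
      \<le> ennreal \<epsilon> * ennreal ((L2_norm f)\<^sup>2)" .
  \<comment> \<open>\<open>L2_norm f\<close> is positive because \<open>norm (f x)\<close> equals
    \<open>norm (c j1)\<close> on the translate of the interval by \<open>j1\<close>.\<close>
  have "ennreal ((norm (c j1))\<^sup>2 * (\<beta> - \<alpha>)) = (\<integral>\<^sup>+x. ennreal ((norm (c j1))\<^sup>2) * indicator {\<alpha> + of_int j1<..<\<beta> + of_int j1} x \<partial>lborel)"
    using I by (simp add: nn_integral_cmult_indicator ennreal_mult)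
  also have "\<dots> \<le> (\<integral>\<^sup>+x. ennreal ((norm (f x))\<^sup>2) \<partial>lborel)"
  proof (rule nn_integral_mono)
    fix x
    have "norm (f x) = norm (c j1)" if "x \<in> {\<alpha> + of_int j1<..<\<beta> + of_int j1}"
    proof -
      have "cnj (f x) = c j1" using f1[of x "- j1" 0] that by simp
      then show ?thesis by (metis complex_mod_cnj)
    qed
    then show "ennreal ((norm (c j1))\<^sup>2) * indicator {\<alpha> + of_int j1<..<\<beta> + of_int j1} x \<le> ennreal ((norm (f x))\<^sup>2)"
      by (auto simp: indicator_def)
  qed
  also have "\<dots> = ennreal ((L2_norm f)\<^sup>2)"
    unfolding L2_norm_sq using f by (intro nn_integral_eq_integral) (auto simp: L2R_def)
  finally have "(norm (c j1))\<^sup>2 * (\<beta> - \<alpha>) \<le> (L2_norm f)\<^sup>2" by simp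
  moreover have "(norm (c j1))\<^sup>2 * (\<beta> - \<alpha>) > 0" using cj I by simp
  ultimately have "L2_norm f \<noteq> 0" by auto
  then have "L2_norm f > 0" using real_sqrt_ge_zero by (simp add: L2_norm_def less_le)
  then show ?thesis using f main by blast
qed

text \<open>A truncated kernel vector at \<open>t0\<close> keeps its small defect on an interval
  ending at \<open>t0\<close>, to the right when \<open>k = h\<close> and to the left when
  \<open>k = l\<close>. The function with these fibres defeats any lower frame bound above
  \<open>\<epsilon>\<close>.\<close>

lemma bounded_kernel_imp_not_frame:
  fixes h l :: "real \<Rightarrow> complex"
  assumes a: "a > 0" and S: "S \<ge> 0"
    and h: "h \<in> borel_measurable borel" and hM: "\<And>t. norm (h t) \<le> M" and lM: "\<And>t. norm (l t) \<le> M"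
    and rc: "\<And>t. (h \<longlongrightarrow> h t) (at_right t)" and ll: "\<And>t. (h \<longlongrightarrow> l t) (at_left t)"
    and hS: "\<And>t. \<bar>t\<bar> > S \<Longrightarrow> h t = 0" and lS: "\<And>t. \<bar>t\<bar> > S \<Longrightarrow> l t = 0"
    and k: "k \<in> {h, l}" and q: "bounded (range q)" "q j1 \<noteq> 0" and ker: "\<And>n. gabor_fibre a k t0 q n = 0" and e: "\<epsilon> > 0"
  shows "\<exists>f\<in>L2R. 0 < L2_norm f \<and>
    (\<integral>\<^sup>+k. ennreal ((norm (L2_inner f (gabor_system h a k)))\<^sup>2) \<partial>count_space UNIV)
      \<le> ennreal \<epsilon> * ennreal ((L2_norm f)\<^sup>2)"
proof -
  have kS: "k t = 0" if "\<bar>t\<bar> > S" for t using k hS lS that by auto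
  have kM: "norm (k t) \<le> M" for t using k hM lM by auto
  obtain c where c: "finite {j. c j \<noteq> 0}" "sqnorm (gabor_fibre a k t0 c) < ennreal \<epsilon> * sqnorm c"
    using truncated_kernel[OF a S kS kM q ker e] by blast
  \<comment> \<open>The strict inequality rules out the zero vector.\<close>
  have "\<exists>j. c j \<noteq> 0" using c(2) by (rule contrapos_pp) (simp add: sqnorm_def)
  then obtain j where j: "c j \<noteq> 0" ..
  have "\<exists>\<alpha> \<beta>. \<alpha> < \<beta> \<and> \<beta> \<le> \<alpha> + 1 \<and> (\<forall>t\<in>{\<alpha><..<\<beta>}. sqnorm (gabor_fibre a h t c) < ennreal \<epsilon> * sqnorm c)"
  proof (cases "k = h")
    case True
    have "((\<lambda>t. h (t + s)) \<longlongrightarrow> k (t0 + s)) (at_right t0)" for s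
    proof (rule filterlim_compose[of h])
      show "(h \<longlongrightarrow> k (t0 + s)) (at_right (t0 + s))" using rc True by simp
      have "((\<lambda>t. t + s) \<longlongrightarrow> t0 + s) (at_right t0)" by (intro tendsto_intros)
      then show "filterlim (\<lambda>t. t + s) (at_right (t0 + s)) (at_right t0)"
        unfolding filterlim_at by (auto simp: eventually_at_filter)
    qed
    from eventually_sqnorm_gabor_fibre_less[OF a S hS kS c at_within_le_nhds this]
    have "eventually (\<lambda>t. sqnorm (gabor_fibre a h t c) < ennreal \<epsilon> * sqnorm c) (at_right t0)" by simp
    then obtain b where b: "b > t0" "\<And>t. t0 < t \<Longrightarrow> t < b \<Longrightarrow> sqnorm (gabor_fibre a h t c) < ennreal \<epsilon> * sqnorm c"
      unfolding eventually_at_right_field by blast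
    \<comment> \<open>The minimum keeps the interval of length at most 1, as disjointness of its
      translates requires.\<close>
    then show ?thesis by (intro exI[of _ t0] exI[of _ "min b (t0 + 1)"]) auto
  next
    case False
    then have kl: "k = l" using k by simp
    have "((\<lambda>t. h (t + s)) \<longlongrightarrow> k (t0 + s)) (at_left t0)" for s
    proof (rule filterlim_compose[of h])
      show "(h \<longlongrightarrow> k (t0 + s)) (at_left (t0 + s))" using ll kl by simp
      have "((\<lambda>t. t + s) \<longlongrightarrow> t0 + s) (at_left t0)" by (intro tendsto_intros)
      then show "filterlim (\<lambda>t. t + s) (at_left (t0 + s)) (at_left t0)"
        unfolding filterlim_at by (auto simp: eventually_at_filter)
    qed
    from eventually_sqnorm_gabor_fibre_less[OF a S hS kS c at_within_le_nhds this]
    have "eventually (\<lambda>t. sqnorm (gabor_fibre a h t c) < ennreal \<epsilon> * sqnorm c) (at_left t0)" by simp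
    then obtain b where b: "b < t0" "\<And>t. b < t \<Longrightarrow> t < t0 \<Longrightarrow> sqnorm (gabor_fibre a h t c) < ennreal \<epsilon> * sqnorm c"
      unfolding eventually_at_left_field by blast
    then show ?thesis by (intro exI[of _ "max b (t0 - 1)"] exI[of _ t0]) auto
  qed
  then obtain \<alpha> \<beta> where I: "\<alpha> < \<beta>" "\<beta> \<le> \<alpha> + 1"
    "\<And>t. t \<in> {\<alpha><..<\<beta>} \<Longrightarrow> sqnorm (gabor_fibre a h t c) < ennreal \<epsilon> * sqnorm c" by blast
  show ?thesis
    by (rule fibre_small_imp_not_lower_bound[OF h hM hS S c(1) j I(1,2)]) (use I(3) e in \<open>auto intro: less_imp_le\<close>)
qed

section \<open>Frame bounds and the equivalence\<close>

text \<open>The uniform fibre bounds are integrated over the unit interval: Schur's test from above,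
  injectivity on bounded sequences from below.\<close>

lemma gabor_frame_bounds:
  fixes h l :: "real \<Rightarrow> complex"
  assumes a: "a > 0" and S: "S \<ge> 0"
    and h: "h \<in> borel_measurable borel" and hM: "\<And>t. norm (h t) \<le> M"
    and rc: "\<And>t. (h \<longlongrightarrow> h t) (at_right t)" and ll: "\<And>t. (h \<longlongrightarrow> l t) (at_left t)"
    and hS: "\<And>t. \<bar>t\<bar> > S \<Longrightarrow> h t = 0" and lS: "\<And>t. \<bar>t\<bar> > S \<Longrightarrow> l t = 0"
    and inj: "\<And>k t0 q. k \<in> {h, l} \<Longrightarrow> bounded (range q) \<Longrightarrow> (\<And>n. gabor_fibre a k t0 q n = 0) \<Longrightarrow> q = (\<lambda>_. 0)"
  shows "\<exists>A>0. \<exists>B>0. \<forall>f\<in>L2R.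
     ennreal A * ennreal ((L2_norm f)\<^sup>2) \<le> (\<integral>\<^sup>+k. ennreal ((norm (L2_inner f (gabor_system h a k)))\<^sup>2) \<partial>count_space UNIV) \<and>
     (\<integral>\<^sup>+k. ennreal ((norm (L2_inner f (gabor_system h a k)))\<^sup>2) \<partial>count_space UNIV) \<le> ennreal B * ennreal ((L2_norm f)\<^sup>2)"
proof -
  have "\<exists>A>0. \<forall>x c. sqnorm c < \<infinity> \<longrightarrow> ennreal A * sqnorm c \<le> sqnorm (gabor_fibre a h x c)"
    by (rule sqnorm_gabor_fibre_ge[OF a rc ll]) (fact hS lS inj)+
  then obtain A where A: "A > 0" "\<And>x c. sqnorm c < \<infinity> \<Longrightarrow> ennreal A * sqnorm c \<le> sqnorm (gabor_fibre a h x c)"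
    by blast
  \<comment> \<open>The added 1 makes \<open>B\<close> positive also when
    \<open>M = 0\<close>.\<close>
  define B where "B = (2 * S + 1) * M\<^sup>2 * (2 * S / a + 1) + 1"
  have B: "B > 0" unfolding B_def using S a by (intro add_nonneg_pos mult_nonneg_nonneg) auto
  have "ennreal A * ennreal ((L2_norm f)\<^sup>2) \<le> (\<integral>\<^sup>+k. ennreal ((norm (L2_inner f (gabor_system h a k)))\<^sup>2) \<partial>count_space UNIV) \<and>
     (\<integral>\<^sup>+k. ennreal ((norm (L2_inner f (gabor_system h a k)))\<^sup>2) \<partial>count_space UNIV) \<le> ennreal B * ennreal ((L2_norm f)\<^sup>2)"
    if f: "f \<in> L2R" for f
  proof
    let ?c = "\<lambda>x j. cnj (f (x + of_int j))"
    note [measurable] = sqnorm_fibre_measurable[OF f]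
    have fib: "(\<integral>\<^sup>+k. ennreal ((norm (L2_inner f (gabor_system h a k)))\<^sup>2) \<partial>count_space UNIV)
      = (\<integral>\<^sup>+x. sqnorm (gabor_fibre a h x (\<lambda>j. cnj (f (x + of_int j)))) \<partial>circle_measure)"
      by (rule gabor_fiberization[OF f h hM hS S])
    \<comment> \<open>The lower fibre bound is available for fibres of finite norm;
      square-integrability of \<open>f\<close> ensures this for almost every
      \<open>x\<close>.\<close>
    have "(\<integral>\<^sup>+x. sqnorm (?c x) \<partial>circle_measure) \<noteq> \<infinity>" unfolding L2_norm_fiberization[OF f, symmetric] by simp
    then have "AE x in circle_measure. sqnorm (?c x) \<noteq> \<infinity>" by (intro nn_integral_PInf_AE) measurable
    then have "AE x in circle_measure. ennreal A * sqnorm (?c x) \<le> sqnorm (gabor_fibre a h x (?c x))"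
      by eventually_elim (auto intro!: A(2) simp: less_top)
    then have "(\<integral>\<^sup>+x. ennreal A * sqnorm (?c x) \<partial>circle_measure) \<le> (\<integral>\<^sup>+x. sqnorm (gabor_fibre a h x (?c x)) \<partial>circle_measure)"
      by (rule nn_integral_mono_AE)
    then show "ennreal A * ennreal ((L2_norm f)\<^sup>2) \<le> (\<integral>\<^sup>+k. ennreal ((norm (L2_inner f (gabor_system h a k)))\<^sup>2) \<partial>count_space UNIV)"
      unfolding fib L2_norm_fiberization[OF f] by (simp add: nn_integral_cmult)
    have "sqnorm (gabor_fibre a h x (?c x)) \<le> ennreal B * sqnorm (?c x)" for x
    proof -
      have "sqnorm (gabor_fibre a h x (?c x)) \<le> ennreal ((2 * S + 1) * M\<^sup>2 * (2 * S / a + 1)) * sqnorm (?c x)"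
        by (rule sqnorm_gabor_fibre_le[OF a S hS hM])
      also have "\<dots> \<le> ennreal B * sqnorm (?c x)"
        by (intro mult_right_mono ennreal_leI) (auto simp: B_def)
      finally show ?thesis .
    qed
    then have "(\<integral>\<^sup>+x. sqnorm (gabor_fibre a h x (?c x)) \<partial>circle_measure) \<le> (\<integral>\<^sup>+x. ennreal B * sqnorm (?c x) \<partial>circle_measure)"
      by (intro nn_integral_mono)
    then show "(\<integral>\<^sup>+k. ennreal ((norm (L2_inner f (gabor_system h a k)))\<^sup>2) \<partial>count_space UNIV) \<le> ennreal B * ennreal ((L2_norm f)\<^sup>2)"
      unfolding fib L2_norm_fiberization[OF f] by (simp add: nn_integral_cmult)
  qed
  then show ?thesis using A(1) B by blast
qed

theorem theorem3p2:
  fixes g :: "real \<Rightarrow> complex" and a :: real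
  assumes "a > 0"
    and "compact (closure {t. g t \<noteq> 0})"
    and "has_one_sided_limits g"
  shows "\<not> L2_frame (gabor_system g a) \<longleftrightarrow>
    (\<exists>t0 :: real. \<exists>q :: int \<Rightarrow> complex.
       bounded (range q) \<and> (\<exists>j. q j \<noteq> 0) \<and>
       (\<exists>h\<in>{right_lim g, left_lim g}. \<forall>n :: int.
          ((\<lambda>j. q j * h (t0 + of_int j - of_int n * a)) has_sum 0) UNIV))"
proof -
  define h l where "h = right_lim g" and "l = left_lim g"
  note lims = assms(3)
  have "bounded {t. g t \<noteq> 0}" using assms(2) compact_imp_bounded bounded_subset closure_subset by blast
  then obtain S where "S > 0" "\<And>t. g t \<noteq> 0 \<Longrightarrow> \<bar>t\<bar> \<le> S" by (auto simp: bounded_pos)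
  then have S: "S \<ge> 0" and gS: "\<And>t. \<bar>t\<bar> > S \<Longrightarrow> g t = 0" by (auto simp: not_le[symmetric])
  obtain M where gM: "\<And>t. norm (g t) \<le> M" using one_sided_limits_bounded[OF lims gS] by blast
  have hM: "norm (h t) \<le> M" and lM: "norm (l t) \<le> M" for t
    using dist_right_lim_le[OF lims open_UNIV UNIV_I, of 0 M t] dist_left_lim_le[OF lims open_UNIV UNIV_I, of 0 M t] gM
    by (simp_all add: h_def l_def)
  have hS: "\<And>t. \<bar>t\<bar> > S \<Longrightarrow> h t = 0" and lS: "\<And>t. \<bar>t\<bar> > S \<Longrightarrow> l t = 0"
    using one_sided_limits_vanish[OF lims gS] by (auto simp: h_def l_def)
  have rc: "(h \<longlongrightarrow> h t) (at_right t)" and ll: "(h \<longlongrightarrow> l t) (at_left t)" for t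
    unfolding h_def l_def by (rule right_lim_at_right[OF lims], rule right_lim_at_left[OF lims])
  have hb: "h \<in> borel_measurable borel" unfolding h_def by (rule right_lim_measurable[OF lims])
  have gb: "g \<in> borel_measurable borel" by (rule one_sided_limits_measurable[OF lims gS])
  have inner: "L2_inner f (gabor_system g a k) = L2_inner f (gabor_system h a k)" if "f \<in> L2R" for f k
    by (rule L2_inner_gabor_cong[OF that gb hb]) (use countable_neq_right_lim[OF lims gS] in \<open>simp add: h_def\<close>)
  let ?N = "\<lambda>f. \<integral>\<^sup>+k. ennreal ((norm (L2_inner f (gabor_system h a k)))\<^sup>2) \<partial>count_space UNIV"
  have frame: "L2_frame (gabor_system g a) \<longleftrightarrow> (\<exists>A>0. \<exists>B>0. \<forall>f\<in>L2R.
     ennreal A * ennreal ((L2_norm f)\<^sup>2) \<le> ?N f \<and> ?N f \<le> ennreal B * ennreal ((L2_norm f)\<^sup>2))"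
    by (subst L2_frame_iff) (auto simp: inner intro: gabor_in_L2R[OF gb gM gS] cong: ball_cong)
  \<comment> \<open>\<open>has_sum\<close> includes convergence, which the bounded support of
    \<open>h\<close> and \<open>l\<close> provides; the condition thus becomes a vanishing
    fibre.\<close>
  have sum0: "((\<lambda>j. q j * k (t0 + of_int j - of_int n * a)) has_sum 0) UNIV \<longleftrightarrow> gabor_fibre a k t0 q n = 0"
    if "k \<in> {h, l}" for k q t0 n
  proof -
    have "((\<lambda>j. q j * k (t0 + of_int j - of_int n * a)) has_sum gabor_fibre a k t0 q n) UNIV"
      by (rule has_sum_gabor_fibre[of S]) (use that hS lS in auto)
    then show ?thesis using has_sum_unique by metis
  qed
  show ?thesis
    unfolding h_def[symmetric] l_def[symmetric]
  proof
    assume nf: "\<not> L2_frame (gabor_system g a)"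
    show "\<exists>t0 q. bounded (range q) \<and> (\<exists>j. q j \<noteq> 0) \<and>
       (\<exists>k\<in>{h, l}. \<forall>n. ((\<lambda>j. q j * k (t0 + of_int j - of_int n * a)) has_sum 0) UNIV)"
    proof (rule ccontr)
      assume no: "\<not> ?thesis"
      have inj: "q = (\<lambda>_. 0)" if "k \<in> {h, l}" "bounded (range q)" "\<And>n. gabor_fibre a k t0 q n = 0" for k t0 q
      proof (rule ccontr)
        assume "q \<noteq> (\<lambda>_. 0)"
        then have "\<exists>j. q j \<noteq> 0" by auto
        moreover have "\<forall>n. ((\<lambda>j. q j * k (t0 + of_int j - of_int n * a)) has_sum 0) UNIV"
          using sum0[OF that(1)] that(3) by blast
        ultimately show False using no that(1,2) by blast
      qed
      have "\<exists>A>0. \<exists>B>0. \<forall>f\<in>L2R. ennreal A * ennreal ((L2_norm f)\<^sup>2) \<le> ?N f \<and>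
          ?N f \<le> ennreal B * ennreal ((L2_norm f)\<^sup>2)"
        by (rule gabor_frame_bounds[OF assms(1) S hb hM rc ll]) (fact hS lS inj)+
      then show False using nf frame by blast
    qed
  next
    assume "\<exists>t0 q. bounded (range q) \<and> (\<exists>j. q j \<noteq> 0) \<and>
       (\<exists>k\<in>{h, l}. \<forall>n. ((\<lambda>j. q j * k (t0 + of_int j - of_int n * a)) has_sum 0) UNIV)"
    then obtain t0 q j1 k where q: "bounded (range q)" "q j1 \<noteq> 0" and k: "k \<in> {h, l}"
      and "\<And>n. ((\<lambda>j. q j * k (t0 + of_int j - of_int n * a)) has_sum 0) UNIV"
      by blast
    then have ker: "\<And>n. gabor_fibre a k t0 q n = 0" using sum0[OF k] by blast
    show "\<not> L2_frame (gabor_system g a)"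
    proof
      assume "L2_frame (gabor_system g a)"
      then obtain A where A: "A > 0" "\<And>f. f \<in> L2R \<Longrightarrow> ennreal A * ennreal ((L2_norm f)\<^sup>2) \<le> ?N f"
        unfolding frame by blast
      \<comment> \<open>Any ratio strictly below \<open>A\<close> contradicts the lower bound, since
        the test function has positive norm.\<close>
      have "A / 2 > 0" using A by simp
      from bounded_kernel_imp_not_frame[OF assms(1) S hb hM lM rc ll hS lS k q ker this]
      obtain f where f: "f \<in> L2R" "0 < L2_norm f" "?N f \<le> ennreal (A / 2) * ennreal ((L2_norm f)\<^sup>2)" by blast
      have "ennreal A * ennreal ((L2_norm f)\<^sup>2) \<le> ennreal (A / 2) * ennreal ((L2_norm f)\<^sup>2)"
        using A(2)[OF f(1)] f(3) by (rule order_trans)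
      then have "A * (L2_norm f)\<^sup>2 \<le> A / 2 * (L2_norm f)\<^sup>2"
        using A(1) by (simp add: ennreal_mult[symmetric])
      then have "A \<le> A / 2" by (rule mult_right_le_imp_le) (use f(2) in simp)
      then show False using A(1) by simp
    qed
  qed
qed

end
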